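(* Let $S=k_{\mathbf p}[x_1,\dots,x_n]$ be a noncommutative PI skew polynomial ring over a field $k$ of characteristic $0$, with center $Z$, with $p_{ij}=\xi^{b_{ij}}$ for a primitive $\ell$th root of unity $\xi$ ($\ell$ minimal) and $B=(b_{ij})$ skew-symmetric over $\mathbb Z$ (full setting in the context). (1) Let $n=2$. Then $Z=k[x_1^\ell,x_2^\ell]$, so $Z$ is regular. (2) Let $n=3$. Then $Z$ is regular if and only if the orders of the roots of unity $\{p_{ij}\}_{i<j}$ are pairwise coprime. (3) Let $n=4$. Let $\rho=\gcd(\ell,\operatorname{pf}(B))$, let $\omega$ be a primitive $\rho$th root of unity, let $c_{ij}=\gcd(b_{ij},\rho)$ and $q_{ij}=\omega^{c_{ij}}$. Then $Z$ is regular if and only if the orders of $\{q_{ij}\}_{i<j}$ are pairwise coprime.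
   Context: Setting: $k$ is a field with $\operatorname{char}k=0$. $\mathbf p=(p_{ij})\in M_n(k)$ is multiplicatively antisymmetric ($p_{ii}=1$, $p_{ji}=p_{ij}^{-1}$) with all $p_{ij}$ roots of unity. $S=k_{\mathbf p}[x_1,\dots,x_n]$ is the $k$-algebra generated by $x_1,\dots,x_n$ with relations $x_jx_i=p_{ij}x_ix_j$, graded by $\deg x_i=1$; $Z$ is its center. $\xi$ is a primitive $\ell$th root of unity and $p_{ij}=\xi^{b_{ij}}$ with integers $b_{ij}$, $b_{ii}=0$, $b_{ji}=-b_{ij}$; $\ell$ is minimal and $\ell>1$ (equivalently $S$ is noncommutative), hence $\gcd(\{b_{ij}\}_{i,j},\ell)=1$. "$Z$ is regular" means that $Z$ is a polynomial ring. $\operatorname{pf}(B)$ is the Pfaffian; for $n=4$, $\operatorname{pf}(B)=b_{12}b_{34}-b_{13}b_{24}+b_{14}b_{23}$. *)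

theory Defs
  imports "HOL-Algebra.QuotRing" "HOL-Algebra.Generated_Rings" "HOL-Library.Poly_Mapping"
begin

section \<open>Free algebras\<close>

text \<open>Lists under concatenation are the free monoid, written additively so that the
  convolution product of \<^theory>\<open>HOL-Library.Poly_Mapping\<close> makes \<open>nat list \<Rightarrow>\<^sub>0 'k\<close> the free
  \<open>'k\<close>-algebra on the type \<^typ>\<open>nat\<close>: \<open>Poly_Mapping.single [i, j] c\<close> is \<open>c x\<^sub>i x\<^sub>j\<close>.\<close>

instantiation list :: (type) monoid_add
begin

definition zero_list :: "'a list" where "zero_list = []"

definition plus_list :: "'a list \<Rightarrow> 'a list \<Rightarrow> 'a list" where "plus_list = (@)"

instance by standard (simp_all add: zero_list_def plus_list_def)

end

definition free_algebra :: "nat \<Rightarrow> (nat list \<Rightarrow>\<^sub>0 'k::field) ring" where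
  "free_algebra n =
    \<lparr>carrier = {f. Poly_Mapping.keys f \<subseteq> lists {1..n}},
     monoid.mult = (*), one = 1, ring.zero = 0, ring.add = (+)\<rparr>"

definition free_const :: "'k \<Rightarrow> (nat list \<Rightarrow>\<^sub>0 'k::field)" where
  "free_const c = Poly_Mapping.single [] c"

definition free_var :: "nat \<Rightarrow> (nat list \<Rightarrow>\<^sub>0 'k::field)" where
  "free_var i = Poly_Mapping.single [i] 1"

lemma free_algebra_ring: "ring (free_algebra n :: (nat list \<Rightarrow>\<^sub>0 'k::field) ring)"
proof (rule ringI)
  show "abelian_group (free_algebra n :: (nat list \<Rightarrow>\<^sub>0 'k) ring)"
  proof (rule abelian_groupI)
    fix x y :: "nat list \<Rightarrow>\<^sub>0 'k"
    assume "x \<in> carrier (free_algebra n)" "y \<in> carrier (free_algebra n)"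
    then show "x \<oplus>\<^bsub>free_algebra n\<^esub> y \<in> carrier (free_algebra n)"
      using keys_add[of x y] unfolding free_algebra_def by fastforce
  next
    fix x :: "nat list \<Rightarrow>\<^sub>0 'k"
    assume "x \<in> carrier (free_algebra n)"
    then show "\<exists>y\<in>carrier (free_algebra n). y \<oplus>\<^bsub>free_algebra n\<^esub> x = \<zero>\<^bsub>free_algebra n\<^esub>"
      by (intro bexI[of _ "- x"]) (simp_all add: free_algebra_def)
  qed (simp_all add: free_algebra_def ac_simps)
  show "Group.monoid (free_algebra n :: (nat list \<Rightarrow>\<^sub>0 'k) ring)"
  proof (rule monoidI)
    fix x y :: "nat list \<Rightarrow>\<^sub>0 'k"
    assume xy: "x \<in> carrier (free_algebra n)" "y \<in> carrier (free_algebra n)"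
    have "u \<in> lists {1..n}" if u: "u \<in> Poly_Mapping.keys (x * y)" for u
    proof -
      obtain v w where "u = v + w" "v \<in> Poly_Mapping.keys x" "w \<in> Poly_Mapping.keys y"
        using u keys_mult[of x y] by blast
      then show ?thesis
        using xy by (simp add: free_algebra_def plus_list_def subset_iff)
    qed
    then show "x \<otimes>\<^bsub>free_algebra n\<^esub> y \<in> carrier (free_algebra n)"
      by (simp add: free_algebra_def subset_iff)
  qed (simp_all add: free_algebra_def mult.assoc zero_list_def)
qed (simp_all add: free_algebra_def distrib_left distrib_right)


section \<open>Skew polynomial rings\<close>

definition skew_relators :: "nat \<Rightarrow> (nat \<Rightarrow> nat \<Rightarrow> 'k) \<Rightarrow> (nat list \<Rightarrow>\<^sub>0 'k::field) set" where
  "skew_relators n p =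
    {free_var j * free_var i - free_const (p i j) * (free_var i * free_var j) | i j.
      i \<in> {1..n} \<and> j \<in> {1..n}}"

text \<open>It matters that the relators lie in the carrier: otherwise the intersection defining
  \<^const>\<open>genideal\<close> would be over the empty family.\<close>

lemma skew_relators_in_carrier: "skew_relators n p \<subseteq> carrier (free_algebra n)"
proof -
  have "Poly_Mapping.keys (free_var j * free_var i - free_const (p i j) * (free_var i * free_var j))
      \<subseteq> lists {1..n}" if "i \<in> {1..n}" "j \<in> {1..n}" for i j
    using that
    by (intro subset_trans[OF keys_diff])
      (auto simp: free_var_def free_const_def mult_single plus_list_def split: if_splits)
  then show ?thesis
    by (auto simp: skew_relators_def free_algebra_def)
qed

definition skew_ideal :: "nat \<Rightarrow> (nat \<Rightarrow> nat \<Rightarrow> 'k) \<Rightarrow> (nat list \<Rightarrow>\<^sub>0 'k::field) set" where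
  "skew_ideal n p = Idl\<^bsub>free_algebra n\<^esub> (skew_relators n p)"

definition skew_poly_ring :: "nat \<Rightarrow> (nat \<Rightarrow> nat \<Rightarrow> 'k) \<Rightarrow> (nat list \<Rightarrow>\<^sub>0 'k::field) set ring" where
  "skew_poly_ring n p = free_algebra n Quot skew_ideal n p"

lemma skew_poly_ring_ring: "ring (skew_poly_ring n p)"
  unfolding skew_poly_ring_def skew_ideal_def
  by (intro ideal.quotient_is_ring ring.genideal_ideal free_algebra_ring skew_relators_in_carrier)

definition skew_const :: "nat \<Rightarrow> (nat \<Rightarrow> nat \<Rightarrow> 'k) \<Rightarrow> 'k \<Rightarrow> (nat list \<Rightarrow>\<^sub>0 'k::field) set" where
  "skew_const n p c = skew_ideal n p +>\<^bsub>free_algebra n\<^esub> free_const c"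

definition skew_var :: "nat \<Rightarrow> (nat \<Rightarrow> nat \<Rightarrow> 'k) \<Rightarrow> nat \<Rightarrow> (nat list \<Rightarrow>\<^sub>0 'k::field) set" where
  "skew_var n p i = skew_ideal n p +>\<^bsub>free_algebra n\<^esub> free_var i"


section \<open>Centers and polynomial rings\<close>

definition ring_center :: "('a, 'm) ring_scheme \<Rightarrow> 'a set" where
  "ring_center R = {z \<in> carrier R. \<forall>s \<in> carrier R. z \<otimes>\<^bsub>R\<^esub> s = s \<otimes>\<^bsub>R\<^esub> z}"

definition skew_center :: "nat \<Rightarrow> (nat \<Rightarrow> nat \<Rightarrow> 'k) \<Rightarrow> (nat list \<Rightarrow>\<^sub>0 'k::field) set ring" where
  "skew_center n p = (skew_poly_ring n p)\<lparr>carrier := ring_center (skew_poly_ring n p)\<rparr>"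

definition poly_ring :: "nat \<Rightarrow> ((nat \<Rightarrow>\<^sub>0 nat) \<Rightarrow>\<^sub>0 'k::field) ring" where
  "poly_ring m =
    \<lparr>carrier = {f. \<forall>u \<in> Poly_Mapping.keys f. Poly_Mapping.keys u \<subseteq> {1..m}},
     monoid.mult = (*), one = 1, ring.zero = 0, ring.add = (+)\<rparr>"

text \<open>A \<open>k\<close>-algebra is given as a ring \<open>A\<close> with its structure map \<open>\<eta>\<close> from \<open>k\<close>; the isomorphism
  is required to be one of \<open>k\<close>-algebras.\<close>

definition is_polynomial_algebra :: "('a, 'm) ring_scheme \<Rightarrow> ('k::field \<Rightarrow> 'a) \<Rightarrow> bool" where
  "is_polynomial_algebra A \<eta> \<longleftrightarrow>
    (\<exists>m. \<exists>h \<in> ring_iso (poly_ring m :: ((nat \<Rightarrow>\<^sub>0 nat) \<Rightarrow>\<^sub>0 'k) ring) A.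
      \<forall>c. h (Poly_Mapping.single 0 c) = \<eta> c)"

definition center_regular :: "nat \<Rightarrow> (nat \<Rightarrow> nat \<Rightarrow> 'k::field) \<Rightarrow> bool" where
  "center_regular n p \<longleftrightarrow> is_polynomial_algebra (skew_center n p) (skew_const n p)"

definition generated_subalgebra :: "('a, 'm) ring_scheme \<Rightarrow> ('k \<Rightarrow> 'a) \<Rightarrow> 'a set \<Rightarrow> 'a set" where
  "generated_subalgebra A \<eta> X = generate_ring A (range \<eta> \<union> X)"


section \<open>Roots of unity and exponent matrices\<close>

definition root_of_unity :: "'k::field \<Rightarrow> bool" where
  "root_of_unity x \<longleftrightarrow> (\<exists>d>0. x ^ d = 1)"

text \<open>Only meaningful for roots of unity.\<close>

definition root_order :: "'k::field \<Rightarrow> nat" where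
  "root_order x = (LEAST d. d > 0 \<and> x ^ d = 1)"

definition primitive_root_of_unity :: "nat \<Rightarrow> 'k::field \<Rightarrow> bool" where
  "primitive_root_of_unity l x \<longleftrightarrow> root_of_unity x \<and> root_order x = l"

definition mult_antisymmetric :: "nat \<Rightarrow> (nat \<Rightarrow> nat \<Rightarrow> 'k::field) \<Rightarrow> bool" where
  "mult_antisymmetric n p \<longleftrightarrow>
    (\<forall>i \<in> {1..n}. p i i = 1) \<and> (\<forall>i \<in> {1..n}. \<forall>j \<in> {1..n}. p j i = inverse (p i j))"

definition skew_symmetric :: "nat \<Rightarrow> (nat \<Rightarrow> nat \<Rightarrow> int) \<Rightarrow> bool" where
  "skew_symmetric n b \<longleftrightarrow>
    (\<forall>i \<in> {1..n}. b i i = 0) \<and> (\<forall>i \<in> {1..n}. \<forall>j \<in> {1..n}. b j i = - b i j)"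

definition exponent_data ::
  "nat \<Rightarrow> (nat \<Rightarrow> nat \<Rightarrow> 'k::field) \<Rightarrow> nat \<Rightarrow> 'k \<Rightarrow> (nat \<Rightarrow> nat \<Rightarrow> int) \<Rightarrow> bool" where
  "exponent_data n p l \<xi> b \<longleftrightarrow>
    primitive_root_of_unity l \<xi> \<and> skew_symmetric n b \<and>
    (\<forall>i \<in> {1..n}. \<forall>j \<in> {1..n}. p i j = \<xi> powi b i j)"

definition minimal_exponent_data ::
  "nat \<Rightarrow> (nat \<Rightarrow> nat \<Rightarrow> 'k::field) \<Rightarrow> nat \<Rightarrow> 'k \<Rightarrow> (nat \<Rightarrow> nat \<Rightarrow> int) \<Rightarrow> bool" where
  "minimal_exponent_data n p l \<xi> b \<longleftrightarrow>
    exponent_data n p l \<xi> b \<and> (\<forall>l' \<xi>' b'. exponent_data n p l' \<xi>' b' \<longrightarrow> l \<le> l')"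

text \<open>Orders are compared for distinct pairs of indices, so equal entries at different positions
  must have order 1.\<close>

definition orders_pairwise_coprime :: "nat \<Rightarrow> (nat \<Rightarrow> nat \<Rightarrow> 'k::field) \<Rightarrow> bool" where
  "orders_pairwise_coprime n q \<longleftrightarrow>
    pairwise (\<lambda>(i, j) (i', j'). coprime (root_order (q i j)) (root_order (q i' j')))
      {(i, j). 1 \<le> i \<and> i < j \<and> j \<le> n}"

definition pfaffian4 :: "(nat \<Rightarrow> nat \<Rightarrow> int) \<Rightarrow> int" where
  "pfaffian4 b = b 1 2 * b 3 4 - b 1 3 * b 2 4 + b 1 4 * b 2 3"

end

theory Submission
  imports Defs "HOL-Library.Multiset"
begin

text \<open>The ordered monomials \<open>x\<^sup>a\<close> form a basis of \<open>S\<close>, so \<open>Z\<close> is spanned by the monomials whose exponents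
  lie in the monoid \<open>H\<close> of all \<open>a\<close> in \<open>\<nat>\<^sup>n\<close> with \<open>B a \<equiv> 0\<close> modulo \<open>\<ell>\<close>. Let \<open>d\<^sub>i\<close> be least with \<open>d\<^sub>i e\<^sub>i \<in> H\<close>.
  Then \<open>Z\<close> is a polynomial ring iff \<open>H\<close> is freely generated by the \<open>d\<^sub>i e\<^sub>i\<close>. Indeed, suppose that \<open>Z\<close> is a
  polynomial ring in \<open>m\<close> variables. A point derivation at the augmentation is determined by its values on
  the variables, and any assignment of values to the irreducible elements of \<open>H\<close> extends to one, so \<open>H\<close> has
  at most \<open>m\<close> irreducibles. A derivation of \<open>Z\<close> that kills powers of \<open>x\<^sub>1, \<dots>, x\<^sub>n\<close> is zero in characteristic
  \<open>0\<close>, whereas a combination of the \<open>m\<close> partial derivatives would do so if \<open>m > n\<close>; so \<open>m \<le> n\<close>, and the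
  \<open>d\<^sub>i e\<^sub>i\<close> are the only irreducibles. What remains is to decide when \<open>B a \<equiv> 0\<close> forces
  \<open>b\<^sub>i\<^sub>j a\<^sub>j \<equiv> 0\<close> for all \<open>i, j\<close>: coprimality of the orders separates the summands of each row, and
  for the converse one tests the columns of the Pfaffian adjoint of \<open>B\<close> (for \<open>n = 3\<close>, the vector spanning
  the kernel of \<open>B\<close>).\<close>

abbreviation lookup where "lookup \<equiv> Poly_Mapping.lookup"
abbreviation keys where "keys \<equiv> Poly_Mapping.keys"
abbreviation single where "single \<equiv> Poly_Mapping.single"

subsection \<open>Linear extension and twisted multiplication\<close>

lemma sum_singles: "(\<Sum>a\<in>keys f. single a (lookup f a)) = f"
  by (rule poly_mapping_eqI)
    (simp add: lookup_sum lookup_single when_def in_keys_iff)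

text \<open>A finitely supported function is the sum of its singles. The support bound travels along
  with the induction, so identities can be checked on singles whose index lies in \<open>A\<close>.
  The rule serves for polynomials and for exponent vectors alike.\<close>

lemma poly_mapping_supp_induct [consumes 1, case_names zero single add]:
  fixes f :: "'a \<Rightarrow>\<^sub>0 'k::comm_monoid_add"
  assumes f: "keys f \<subseteq> A"
    and zero: "P 0"
    and single: "\<And>a c. a \<in> A \<Longrightarrow> P (single a c)"
    and add: "\<And>f g. keys f \<subseteq> A \<Longrightarrow> keys g \<subseteq> A \<Longrightarrow> P f \<Longrightarrow> P g \<Longrightarrow> P (f + g)"
  shows "P f"
proof -
  have "P (\<Sum>a\<in>B. single a (lookup f a)) \<and> keys (\<Sum>a\<in>B. single a (lookup f a)) \<subseteq> A"
    if "finite B" "B \<subseteq> A" for B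
    using that
  proof (induction B rule: finite_induct)
    case (insert b B)
    let ?s = "single b (lookup f b)" and ?t = "\<Sum>a\<in>B. single a (lookup f a)"
    have "keys ?s \<subseteq> A" "keys ?t \<subseteq> A" "P ?t"
      using insert by auto
    moreover have "P ?s"
      using insert by (intro single) auto
    ultimately have "P (?s + ?t) \<and> keys (?s + ?t) \<subseteq> A"
      using add[of ?s ?t] keys_add[of ?s ?t] by blast
    with insert.hyps show ?case
      by simp
  qed (simp add: zero)
  from this[OF finite_keys f] show ?thesis
    by (simp add: sum_singles)
qed

lemma poly_mapping_single_induct [case_names zero single add]:
  fixes f :: "'a \<Rightarrow>\<^sub>0 'k::comm_monoid_add"
  assumes "P 0" "\<And>a c. P (single a c)" "\<And>f g. P f \<Longrightarrow> P g \<Longrightarrow> P (f + g)"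
  shows "P f"
  using subset_UNIV[of "keys f"] by (induction rule: poly_mapping_supp_induct) (simp_all add: assms)

text \<open>The linear map that sends the basis vector \<open>a\<close> to \<open>c a\<close> times
  the basis vector \<open>\<phi> a\<close>. Normal forms, partial derivatives, dilations of
  exponents and both directions of the polynomial isomorphism are of this shape.\<close>

definition lin :: "('a \<Rightarrow> 'b) \<Rightarrow> ('a \<Rightarrow> 'k) \<Rightarrow> ('a \<Rightarrow>\<^sub>0 'k) \<Rightarrow> ('b \<Rightarrow>\<^sub>0 'k::semiring_0)" where
  "lin \<phi> c f = (\<Sum>a\<in>keys f. single (\<phi> a) (c a * lookup f a))"

lemma lin_superset:
  assumes "finite A" "keys f \<subseteq> A"
  shows "lin \<phi> c f = (\<Sum>a\<in>A. single (\<phi> a) (c a * lookup f a))"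
  unfolding lin_def by (rule sum.mono_neutral_left) (auto simp: assms in_keys_iff)

lemma lin_zero [simp]: "lin \<phi> c 0 = 0"
  by (simp add: lin_def)

lemma lin_single [simp]: "lin \<phi> c (single a x) = single (\<phi> a) (c a * x)"
  by (simp add: lin_def)

lemma lin_add: "lin \<phi> c (f + g) = lin \<phi> c f + lin \<phi> c g"
  by (subst (1 2 3) lin_superset[where A = "keys f \<union> keys g"])
    (auto simp: keys_add lookup_add distrib_left single_add sum.distrib)

lemma keys_lin: "keys (lin \<phi> c f) \<subseteq> \<phi> ` keys f"
  unfolding lin_def by (rule subset_trans[OF keys_sum]) auto

lemma lin_lin: "lin \<phi> c (lin \<psi> d f) = lin (\<lambda>a. \<phi> (\<psi> a)) (\<lambda>a. c (\<psi> a) * d a) f"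
  by (induction f rule: poly_mapping_single_induct) (simp_all add: lin_add mult.assoc)

lemma lin_ident:
  fixes f :: "'a \<Rightarrow>\<^sub>0 'k::semiring_1"
  assumes "\<And>a. a \<in> keys f \<Longrightarrow> \<phi> a = a \<and> c a = 1"
  shows "lin \<phi> c f = f"
proof -
  have "lin \<phi> c f = (\<Sum>a\<in>keys f. single a (lookup f a))"
    unfolding lin_def by (intro sum.cong) (auto simp: assms)
  then show ?thesis
    by (simp add: sum_singles)
qed

lemma lookup_lin_inj:
  assumes "inj \<phi>"
  shows "lookup (lin \<phi> c f) (\<phi> a) = c a * lookup f a"
proof -
  have "\<phi> x = \<phi> a \<longleftrightarrow> x = a" for x
    using assms by (auto dest: injD)
  then show ?thesis
    by (simp add: lin_def lookup_sum lookup_single when_def in_keys_iff)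
qed

text \<open>The product of a monoid algebra twisted by \<open>\<sigma>\<close>: basis vectors
  \<open>a\<close> and \<open>b\<close> multiply to \<open>\<sigma> a b\<close> times the basis
  vector \<open>a + b\<close>.\<close>

definition tmult :: "('a \<Rightarrow> 'a \<Rightarrow> 'k) \<Rightarrow> ('a \<Rightarrow>\<^sub>0 'k) \<Rightarrow> ('a \<Rightarrow>\<^sub>0 'k) \<Rightarrow> ('a::monoid_add \<Rightarrow>\<^sub>0 'k::comm_semiring_0)"
  where "tmult \<sigma> f g = (\<Sum>a\<in>keys f. lin ((+) a) (\<lambda>b. \<sigma> a b * lookup f a) g)"

lemma tmult_superset:
  assumes "finite A" "keys f \<subseteq> A"
  shows "tmult \<sigma> f g = (\<Sum>a\<in>A. lin ((+) a) (\<lambda>b. \<sigma> a b * lookup f a) g)"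
  unfolding tmult_def by (rule sum.mono_neutral_left) (auto simp: assms in_keys_iff lin_def)

lemma tmult_add_right: "tmult \<sigma> f (g + h) = tmult \<sigma> f g + tmult \<sigma> f h"
  by (simp add: tmult_def lin_add sum.distrib)

lemma lin_coeff_add: "lin \<phi> (\<lambda>a. c a + d a) f = lin \<phi> c f + lin \<phi> d f"
  by (simp add: lin_def distrib_right single_add sum.distrib)

lemma tmult_add_left: "tmult \<sigma> (f + g) h = tmult \<sigma> f h + tmult \<sigma> g h"
  by (subst (1 2 3) tmult_superset[where A = "keys f \<union> keys g"])
    (auto simp: keys_add lookup_add distrib_left lin_coeff_add sum.distrib)

lemma tmult_zero [simp]: "tmult \<sigma> 0 f = 0" "tmult \<sigma> f 0 = 0"
  by (simp_all add: tmult_def)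

lemma tmult_single_left:
  "tmult \<sigma> (single a x) g = lin ((+) a) (\<lambda>b. \<sigma> a b * x) g"
  by (cases "x = 0") (simp_all add: tmult_def lin_def)

lemma tmult_single_right:
  "tmult \<sigma> f (single b y) = lin (\<lambda>a. a + b) (\<lambda>a. \<sigma> a b * y) f"
  unfolding tmult_def by (simp add: lin_def algebra_simps)

lemma tmult_single_single [simp]:
  "tmult \<sigma> (single a x) (single b y) = single (a + b) (\<sigma> a b * x * y)"
  by (simp add: tmult_single_left)

lemma keys_tmult: "keys (tmult \<sigma> f g) \<subseteq> {a + b | a b. a \<in> keys f \<and> b \<in> keys g}"
  unfolding tmult_def by (rule subset_trans[OF keys_sum]) (use keys_lin in fastforce)

lemma tmult_eq_mult: "tmult (\<lambda>_ _. 1) f g = f * (g :: 'a::monoid_add \<Rightarrow>\<^sub>0 'k::comm_semiring_1)"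
proof (induction f rule: poly_mapping_single_induct)
  case (single a x)
  show ?case
    by (induction g rule: poly_mapping_single_induct)
      (simp_all add: mult_single tmult_add_right distrib_left)
qed (simp_all add: tmult_add_left distrib_right)

text \<open>Both sides are trilinear, and on three basis vectors the claim is the 2-cocycle
  identity.\<close>

lemma tmult_assoc:
  assumes cocycle: "\<And>a b c. \<sigma> a b * \<sigma> (a + b) c = \<sigma> b c * \<sigma> a (b + c)"
  shows "tmult \<sigma> (tmult \<sigma> f g) h = tmult \<sigma> f (tmult \<sigma> g h)"
proof (induction f rule: poly_mapping_single_induct)
  case (single a x)
  show ?case
  proof (induction g rule: poly_mapping_single_induct)
    case (single b y)
    show ?case
    proof (induction h rule: poly_mapping_single_induct)
      case (single c z)
      have "\<sigma> (a + b) c * (\<sigma> a b * x * y) * z = (\<sigma> a b * \<sigma> (a + b) c) * (x * y * z)"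
        by (simp add: ac_simps)
      also have "\<dots> = \<sigma> a (b + c) * x * (\<sigma> b c * y * z)"
        unfolding cocycle by (simp add: ac_simps)
      finally show ?case
        by (simp add: add.assoc)
    qed (simp_all add: tmult_add_right)
  qed (simp_all add: tmult_add_left tmult_add_right)
qed (simp_all add: tmult_add_left)

text \<open>By bilinearity only basis vectors matter. There \<open>coeff\<close> says that
  \<open>\<sigma>\<close> and the pullback of \<open>\<tau>\<close> along \<open>\<phi>\<close>
  differ by the coboundary of \<open>c\<close>.\<close>

lemma lin_tmult:
  assumes f: "keys f \<subseteq> A" and g: "keys g \<subseteq> A"
    and hom: "\<And>a b. a \<in> A \<Longrightarrow> b \<in> A \<Longrightarrow> \<phi> (a + b) = \<phi> a + \<phi> b"
    and coeff: "\<And>a b. a \<in> A \<Longrightarrow> b \<in> A \<Longrightarrow> c (a + b) * \<sigma> a b = \<tau> (\<phi> a) (\<phi> b) * c a * c b"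
  shows "lin \<phi> c (tmult \<sigma> f g) = tmult \<tau> (lin \<phi> c f) (lin \<phi> c g)"
  using f
proof (induction f rule: poly_mapping_supp_induct)
  case (single a x)
  from g show ?case
  proof (induction g rule: poly_mapping_supp_induct)
    case (single b y)
    have "c (a + b) * (\<sigma> a b * x * y) = (c (a + b) * \<sigma> a b) * (x * y)"
      by (simp add: ac_simps)
    also have "\<dots> = \<tau> (\<phi> a) (\<phi> b) * (c a * x) * (c b * y)"
      by (simp only: coeff[OF \<open>a \<in> A\<close> \<open>b \<in> A\<close>]) (simp add: ac_simps)
    finally show ?case
      using \<open>a \<in> A\<close> \<open>b \<in> A\<close> by (simp add: hom)
  qed (simp_all add: tmult_add_right lin_add)
qed (simp_all add: tmult_add_left lin_add)

subsection \<open>The basis theorem\<close>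

definition exponents :: "nat \<Rightarrow> (nat \<Rightarrow>\<^sub>0 nat) set" where
  "exponents n = {u. keys u \<subseteq> {1..n}}"

lemma exponents_zero [simp]: "0 \<in> exponents n"
  by (simp add: exponents_def)

lemma exponents_single [simp]: "i \<in> {1..n} \<Longrightarrow> single i t \<in> exponents n"
  by (simp add: exponents_def)

lemma exponents_add [simp]: "a \<in> exponents n \<Longrightarrow> b \<in> exponents n \<Longrightarrow> a + b \<in> exponents n"
  using keys_add[of a b] by (auto simp: exponents_def)

lemma exponents_eq_zero: "a \<in> exponents n \<Longrightarrow> i \<notin> {1..n} \<Longrightarrow> lookup a i = 0"
  by (auto simp: exponents_def in_keys_iff)

lemma keys_tmult_exponents:
  "keys f \<subseteq> exponents n \<Longrightarrow> keys g \<subseteq> exponents n \<Longrightarrow> keys (tmult \<tau> f g) \<subseteq> exponents n"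
  using keys_tmult[of \<tau> f g] exponents_add by blast

definition word_exponent :: "nat list \<Rightarrow> (nat \<Rightarrow>\<^sub>0 nat)" where
  "word_exponent w = (\<Sum>i\<leftarrow>w. single i 1)"

lemma word_exponent_simps [simp]:
  "word_exponent [] = 0" "word_exponent (i # w) = single i 1 + word_exponent w"
  "word_exponent (v @ w) = word_exponent v + word_exponent w"
  by (simp_all add: word_exponent_def)

lemma lookup_word_exponent: "lookup (word_exponent w) i = count (mset w) i"
  by (induction w) (auto simp: lookup_add lookup_single when_def)

lemma word_exponent_eq_iff: "word_exponent v = word_exponent w \<longleftrightarrow> mset v = mset w"
  by (simp add: poly_mapping_eq_iff fun_eq_iff lookup_word_exponent multiset_eq_iff)

lemma word_exponent_in_exponents: "w \<in> lists {1..n} \<Longrightarrow> word_exponent w \<in> exponents n"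
  by (induction w) auto

lemma obtain_word:
  assumes "a \<in> exponents n"
  obtains w where "w \<in> lists {1..n}" "word_exponent w = a"
proof
  let ?w = "concat (map (\<lambda>i. replicate (lookup a i) i) [1..<Suc n])"
  have count: "count (mset (concat (map (\<lambda>i. replicate (f i) i) xs))) j = (if j \<in> set xs then f j else 0)"
    if "distinct xs" for xs f and j :: nat
    using that by (induction xs) auto
  show "?w \<in> lists {1..n}"
    by auto
  show "word_exponent ?w = a"
  proof (rule poly_mapping_eqI)
    fix j
    show "lookup (word_exponent ?w) j = lookup a j"
      unfolding lookup_word_exponent
      by (subst count) (use exponents_eq_zero[OF assms, of j] in \<open>auto simp del: upt_Suc\<close>)
  qed
qed

section \<open>The model algebra: ordered monomials with a twisted product\<close>

locale skew =
  fixes n :: nat and p :: "nat \<Rightarrow> nat \<Rightarrow> 'k::field"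
  assumes antisym: "mult_antisymmetric n p"
    and roots: "\<forall>i \<in> {1..n}. \<forall>j \<in> {1..n}. root_of_unity (p i j)"
begin

lemma p_nonzero: "i \<in> {1..n} \<Longrightarrow> j \<in> {1..n} \<Longrightarrow> p i j \<noteq> 0"
proof
  assume ij: "i \<in> {1..n}" "j \<in> {1..n}" and "p i j = 0"
  moreover have "root_of_unity (p i j)"
    using roots ij by blast
  ultimately show False
    by (auto simp: root_of_unity_def zero_power)
qed

lemma p_diag: "i \<in> {1..n} \<Longrightarrow> p i i = 1"
  using antisym unfolding mult_antisymmetric_def by blast

lemma p_swap: "i \<in> {1..n} \<Longrightarrow> j \<in> {1..n} \<Longrightarrow> p j i = inverse (p i j)"
  using antisym unfolding mult_antisymmetric_def by blast

lemma p_swap_mult: "i \<in> {1..n} \<Longrightarrow> j \<in> {1..n} \<Longrightarrow> p i j * p j i = 1"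
  using p_swap[of i j] p_nonzero[of i j] by simp

text \<open>Normal ordering of a product of two monomials: moving \<open>x\<^sub>j\<close> of the left factor past \<open>x\<^sub>i\<close> of
  the right factor, for \<open>i < j\<close>, costs a factor \<open>p\<^sub>i\<^sub>j\<close>.\<close>

definition sig :: "(nat \<Rightarrow>\<^sub>0 nat) \<Rightarrow> (nat \<Rightarrow>\<^sub>0 nat) \<Rightarrow> 'k" where
  "sig a b = (\<Prod>i\<in>{1..n}. \<Prod>j\<in>{i<..n}. p i j ^ (lookup a j * lookup b i))"

lemma sig_add_left: "sig (a + b) c = sig a c * sig b c"
  by (simp add: sig_def lookup_add distrib_right power_add prod.distrib)

lemma sig_add_right: "sig a (b + c) = sig a b * sig a c"
  by (simp add: sig_def lookup_add distrib_left power_add prod.distrib)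

lemma sig_zero [simp]: "sig 0 a = 1" "sig a 0 = 1"
  by (simp_all add: sig_def)

lemma sig_nonzero: "sig a b \<noteq> 0"
  by (simp add: sig_def prod_zero_iff p_nonzero)

lemma sig_single_single:
  assumes "i \<in> {1..n}" "j \<in> {1..n}"
  shows "sig (single j s) (single i t) = (if i < j then p i j ^ (s * t) else 1)"
proof -
  have "sig (single j s) (single i t)
      = (\<Prod>i'\<in>{1..n}. \<Prod>j'\<in>{i'<..n}. if j' = j then if i' = i then p i j ^ (s * t) else 1 else 1)"
    unfolding sig_def
  proof (intro prod.cong refl)
    fix i' j'
    show "p i' j' ^ (lookup (single j s) j' * lookup (single i t) i')
        = (if j' = j then if i' = i then p i j ^ (s * t) else 1 else 1)"
      by (cases "j' = j"; cases "i' = i") (simp_all add: lookup_single)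
  qed
  also have "\<dots> = (\<Prod>i'\<in>{1..n}. if i' = i then if i < j then p i j ^ (s * t) else 1 else 1)"
    using assms by (intro prod.cong refl) (simp add: prod.delta)
  also have "\<dots> = (if i < j then p i j ^ (s * t) else 1)"
    using assms by (simp add: prod.delta)
  finally show ?thesis .
qed

text \<open>A power of x_i standing to the left of a monomial without smaller variables is already
  in normal order, so no scalar appears.\<close>

lemma sig_single_eq_1:
  assumes "\<And>j. j < i \<Longrightarrow> lookup a j = 0"
  shows "sig (single i s) a = 1"
  unfolding sig_def
proof (intro prod.neutral ballI)
  fix i' j' assume "j' \<in> {i'<..n}"
  then show "p i' j' ^ (lookup (single i s) j' * lookup a i') = 1"
    using assms[of i'] by (cases "j' = i") (simp_all add: lookup_single)
qed

text \<open>A concrete copy of S in which the ordered monomials are a basis by construction: the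
  monoid algebra of the exponent vectors, twisted by the bicharacter \<open>sig\<close>.\<close>

definition model :: "((nat \<Rightarrow>\<^sub>0 nat) \<Rightarrow>\<^sub>0 'k) ring" where
  "model = \<lparr>carrier = {f. keys f \<subseteq> exponents n},
     monoid.mult = tmult sig, one = 1, ring.zero = 0, ring.add = (+)\<rparr>"

lemma tmult_sig_assoc: "tmult sig (tmult sig f g) h = tmult sig f (tmult sig g h)"
  by (rule tmult_assoc) (simp add: sig_add_left sig_add_right)

lemma tmult_sig_one [simp]: "tmult sig 1 f = f" "tmult sig f 1 = f"
  by (simp_all add: tmult_single_left tmult_single_right lin_ident flip: single_one)

lemma model_ring: "ring model"
proof (rule ringI)
  show "abelian_group model"
  proof (rule abelian_groupI)
    fix x y assume "x \<in> carrier model" "y \<in> carrier model"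
    then show "x \<oplus>\<^bsub>model\<^esub> y \<in> carrier model"
      using keys_add[of x y] unfolding model_def by fastforce
  next
    fix x assume "x \<in> carrier model"
    then show "\<exists>y\<in>carrier model. y \<oplus>\<^bsub>model\<^esub> x = \<zero>\<^bsub>model\<^esub>"
      by (intro bexI[of _ "- x"]) (simp_all add: model_def)
  qed (simp_all add: model_def ac_simps)
  show "Group.monoid model"
    by (rule monoidI) (simp_all add: model_def tmult_sig_assoc keys_tmult_exponents)
qed (simp_all add: model_def tmult_add_left tmult_add_right)

text \<open>The scalar by which a word differs from its sorted rearrangement in S, collected letter
  by letter from the right.\<close>

primrec word_coeff :: "nat list \<Rightarrow> 'k" where
  "word_coeff [] = 1"
| "word_coeff (i # w) = sig (single i 1) (word_exponent w) * word_coeff w"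

lemma word_coeff_append:
  "word_coeff (v @ w) = sig (word_exponent v) (word_exponent w) * word_coeff v * word_coeff w"
  by (induction v) (simp_all add: sig_add_left sig_add_right ac_simps)

lemma word_coeff_nonzero: "word_coeff w \<noteq> 0"
  by (induction w) (simp_all add: sig_nonzero)

definition normal_form :: "(nat list \<Rightarrow>\<^sub>0 'k) \<Rightarrow> ((nat \<Rightarrow>\<^sub>0 nat) \<Rightarrow>\<^sub>0 'k)" where
  "normal_form = lin word_exponent word_coeff"

text \<open>The free algebra is a monoid algebra with trivial twist, and
  \<open>word_coeff_append\<close> says that \<open>sig\<close>, pulled back to words, is the
  coboundary of \<open>word_coeff\<close>.\<close>

lemma normal_form_mult: "normal_form (f * g) = tmult sig (normal_form f) (normal_form g)"
  unfolding normal_form_def tmult_eq_mult[symmetric]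
  by (rule lin_tmult[where A = UNIV]) (simp_all add: plus_list_def word_coeff_append)

lemma normal_form_hom: "ring_hom_ring (free_algebra n) model normal_form"
proof (rule ring_hom_ringI)
  fix f :: "nat list \<Rightarrow>\<^sub>0 'k"
  assume "f \<in> carrier (free_algebra n)"
  then show "normal_form f \<in> carrier model"
    using keys_lin[of word_exponent word_coeff f] word_exponent_in_exponents[of _ n]
    by (simp add: free_algebra_def model_def normal_form_def) blast
next
  have "normal_form 1 = single (word_exponent 0) (word_coeff 0 * 1)"
    unfolding normal_form_def by (simp only: lin_single flip: single_one)
  then show "normal_form \<one>\<^bsub>free_algebra n\<^esub> = \<one>\<^bsub>model\<^esub>"
    by (simp add: free_algebra_def model_def zero_list_def)
qed (simp_all add: free_algebra_ring model_ring, simp_all add: free_algebra_def model_def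
      normal_form_mult, simp_all add: normal_form_def lin_add)

lemma normal_form_surj: "normal_form ` carrier (free_algebra n) = carrier model"
proof
  show "normal_form ` carrier (free_algebra n) \<subseteq> carrier model"
    using ring_hom_memE(1)[OF ring_hom_ring.homh[OF normal_form_hom]] by blast
  show "carrier model \<subseteq> normal_form ` carrier (free_algebra n)"
  proof
    fix g assume "g \<in> carrier model"
    then have "keys g \<subseteq> exponents n"
      by (simp add: model_def)
    then show "g \<in> normal_form ` carrier (free_algebra n)"
    proof (induction g rule: poly_mapping_supp_induct)
      case zero
      then show ?case
        by (intro image_eqI[of _ _ 0]) (simp_all add: normal_form_def free_algebra_def)
    next
      case (single a c)
      \<comment> \<open>Any word with this exponent will do: its coefficient is nonzero and can be
        divided out.\<close>
      then obtain w where "w \<in> lists {1..n}" "word_exponent w = a"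
        by (elim obtain_word)
      then show ?case
        by (intro image_eqI[of _ _ "single w (c / word_coeff w)"])
          (auto simp: normal_form_def free_algebra_def word_coeff_nonzero)
    next
      case (add g h)
      then obtain g' h' where "g = normal_form g'" "g' \<in> carrier (free_algebra n)"
        "h = normal_form h'" "h' \<in> carrier (free_algebra n)"
        by blast
      then show ?case
        using keys_add[of g' h']
        by (intro image_eqI[of _ _ "g' + h'"]) (auto simp: normal_form_def free_algebra_def lin_add)
    qed
  qed
qed

abbreviation I where "I \<equiv> skew_ideal n p"

lemma skew_ideal: "ideal I (free_algebra n)"
  unfolding skew_ideal_def
  by (intro ring.genideal_ideal free_algebra_ring skew_relators_in_carrier)

lemma I_zero: "0 \<in> I" and I_add: "f \<in> I \<Longrightarrow> g \<in> I \<Longrightarrow> f + g \<in> I"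
proof -
  have sub: "additive_subgroup I (free_algebra n)"
    by (rule ideal.axioms(1)[OF skew_ideal])
  show "0 \<in> I"
    using additive_subgroup.zero_closed[OF sub] by (simp add: free_algebra_def)
  show "f \<in> I \<Longrightarrow> g \<in> I \<Longrightarrow> f + g \<in> I"
    using additive_subgroup.a_closed[OF sub, of f g] by (simp add: free_algebra_def)
qed

lemma I_mult:
  assumes "f \<in> I" "keys g \<subseteq> lists {1..n}"
  shows "g * f \<in> I" "f * g \<in> I"
proof -
  interpret ideal I "free_algebra n" by (rule skew_ideal)
  show "g * f \<in> I" "f * g \<in> I"
    using I_l_closed[of f g] I_r_closed[of f g] assms by (simp_all add: free_algebra_def)
qed

lemma I_relator:
  assumes "i \<in> {1..n}" "j \<in> {1..n}"
  shows "single [j, i] 1 - single [i, j] (p i j) \<in> I"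
proof -
  have "free_var j * free_var i - free_const (p i j) * (free_var i * free_var j) \<in> skew_relators n p"
    unfolding skew_relators_def using assms by blast
  then have "free_var j * free_var i - free_const (p i j) * (free_var i * free_var j) \<in> I"
    unfolding skew_ideal_def
    by (rule subsetD[OF ring.genideal_self[OF free_algebra_ring skew_relators_in_carrier]])
  then show ?thesis
    by (simp add: free_var_def free_const_def mult_single plus_list_def)
qed

section \<open>Sorting words modulo the defining ideal\<close>

lemma word_exponent_insort [simp]: "word_exponent (insort i w) = single i 1 + word_exponent w"
  and word_exponent_sort [simp]: "word_exponent (sort w) = word_exponent w"
  unfolding word_exponent_simps(2)[symmetric] word_exponent_eq_iff by simp_all

text \<open>The letter \<open>i\<close> travels right past smaller letters by adjacent swaps, each
  given by a relator. The scalars multiply up to \<open>sig\<close> because \<open>sig\<close> is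
  multiplicative in its second argument.\<close>

lemma insort_mod_I:
  assumes "i \<in> {1..n}" "w \<in> lists {1..n}" "sorted w"
  shows "single (i # w) 1 - single (insort i w) (sig (single i 1) (word_exponent w)) \<in> I"
  using assms
proof (induction w)
  case Nil
  then show ?case by (simp add: I_zero)
next
  case (Cons t w)
  show ?case
  proof (cases "i \<le> t")
    case True
    have "lookup (word_exponent (t # w)) j = 0" if "j < i" for j
      unfolding lookup_word_exponent using Cons.prems that True by (auto simp: not_in_iff[symmetric])
    then have "sig (single i 1) (word_exponent (t # w)) = 1"
      by (rule sig_single_eq_1)
    then show ?thesis
      using True by (simp add: I_zero)
  next
    case False
    let ?s = "sig (single i 1) (word_exponent w)"
    from Cons.prems have t: "t \<in> {1..n}" and w: "w \<in> lists {1..n}"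
      by auto
    \<comment> \<open>First swap \<open>i\<close> with the head \<open>t\<close>, then insert
      \<open>i\<close> behind \<open>t\<close> by the induction hypothesis; both errors lie in
      \<open>I\<close>.\<close>
    have "(single [i, t] 1 - single [t, i] (p t i)) * single w 1
        + single [t] (p t i) * (single (i # w) 1 - single (insort i w) ?s) \<in> I"
      using Cons t w by (intro I_add I_mult I_relator Cons.IH) auto
    also have "(single [i, t] 1 - single [t, i] (p t i)) * single w 1
        + single [t] (p t i) * (single (i # w) 1 - single (insort i w) ?s)
        = single (i # t # w) 1 - single (t # insort i w) (p t i * ?s)"
      by (simp add: algebra_simps mult_single plus_list_def)
    finally show ?thesis
      using False Cons.prems t by (simp add: sig_add_right sig_single_single)
  qed
qed

text \<open>Insertion sort modulo \<open>I\<close>: the tail is sorted first, then the head is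
  inserted.\<close>

lemma sort_mod_I:
  assumes "w \<in> lists {1..n}"
  shows "single w 1 - single (sort w) (word_coeff w) \<in> I"
  using assms
proof (induction w)
  case Nil
  then show ?case by (simp add: I_zero)
next
  case (Cons i w)
  let ?s = "sig (single i 1) (word_exponent w)"
  have "sort w \<in> lists {1..n}"
    using Cons by (auto simp: lists_eq_set)
  with Cons have "single [i] 1 * (single w 1 - single (sort w) (word_coeff w))
      + single [] (word_coeff w) * (single (i # sort w) 1 - single (insort i (sort w)) ?s) \<in> I"
    using insort_mod_I[of i "sort w"] by (intro I_add I_mult) auto
  also have "single [i] 1 * (single w 1 - single (sort w) (word_coeff w))
      + single [] (word_coeff w) * (single (i # sort w) 1 - single (insort i (sort w)) ?s)
      = single (i # w) 1 - single (sort (i # w)) (word_coeff (i # w))"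
    by (simp add: algebra_simps mult_single plus_list_def)
  finally show ?case .
qed

text \<open>Modulo \<open>I\<close>, \<open>f\<close> equals the combination
  \<open>lin sort word_coeff f\<close> of sorted words. That combination is a function of the normal
  form, because a sorted word is determined by its exponent.\<close>

lemma normal_form_eq_0_imp:
  assumes f: "keys f \<subseteq> lists {1..n}" and "normal_form f = 0"
  shows "f \<in> I"
proof -
  \<comment> \<open>The choice is immaterial: words with equal exponent are permutations of each
    other and have the same sorted form.\<close>
  define s where "s a = sort (SOME w. word_exponent w = a)" for a
  have s: "s (word_exponent w) = sort w" for w
  proof -
    have "word_exponent (SOME v. word_exponent v = word_exponent w) = word_exponent w"
      by (rule someI) simp
    then show ?thesis
      unfolding s_def by (simp add: word_exponent_eq_iff properties_for_sort)
  qed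
  have "lin s (\<lambda>_. 1) (normal_form f) = lin sort word_coeff f"
    unfolding normal_form_def lin_lin by (simp add: s)
  with assms(2) have "lin sort word_coeff f = 0"
    by simp
  moreover have "f - lin sort word_coeff f \<in> I"
    using f
  proof (induction f rule: poly_mapping_supp_induct)
    case (single w c)
    then have "single [] c * (single w 1 - single (sort w) (word_coeff w)) \<in> I"
      by (intro I_mult sort_mod_I) auto
    then show ?case
      by (simp add: algebra_simps mult_single plus_list_def)
  next
    case (add f g)
    then have "(f - lin sort word_coeff f) + (g - lin sort word_coeff g) \<in> I"
      by (intro I_add)
    then show ?case
      by (simp add: lin_add algebra_simps)
  qed (simp add: I_zero)
  ultimately show ?thesis
    by simp
qed

text \<open>The relators vanish in the model, and conversely whatever has zero normal form reduces
  to zero modulo the relators. Hence the ordered monomials form a basis of S.\<close>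

lemma kernel_normal_form: "a_kernel (free_algebra n) model normal_form = I"
proof
  show "a_kernel (free_algebra n) model normal_form \<subseteq> I"
  proof
    fix f assume "f \<in> a_kernel (free_algebra n) model normal_form"
    then show "f \<in> I"
      by (intro normal_form_eq_0_imp) (simp_all add: a_kernel_def' free_algebra_def model_def)
  qed
  have "normal_form (free_var j * free_var i - free_const (p i j) * (free_var i * free_var j)) = 0"
    if "i \<in> {1..n}" "j \<in> {1..n}" for i j
  proof -
    have "normal_form (single [j, i] 1) = single (single i 1 + single j 1) (sig (single j 1) (single i 1))"
      "normal_form (single [i, j] (- p i j))
        = single (single i 1 + single j 1) (- (sig (single i 1) (single j 1) * p i j))"
      by (simp_all add: normal_form_def add.commute)
    then have "normal_form (single [j, i] 1 + single [i, j] (- p i j))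
        = single (single i 1 + single j 1)
            (sig (single j 1) (single i 1) - sig (single i 1) (single j 1) * p i j)"
      by (simp add: normal_form_def lin_add diff_conv_add_uminus single_add del: add_uminus_conv_diff)
    also have "sig (single j 1) (single i 1) - sig (single i 1) (single j 1) * p i j = 0"
      using that p_swap_mult[of i j] p_diag[of i]
      by (cases i j rule: linorder_cases) (simp_all add: sig_single_single mult.commute)
    finally show ?thesis
      by (simp add: free_var_def free_const_def mult_single plus_list_def single_uminus)
  qed
  then have "\<forall>r\<in>skew_relators n p. normal_form r = 0"
    unfolding skew_relators_def by blast
  then have "skew_relators n p \<subseteq> a_kernel (free_algebra n) model normal_form"
    using skew_relators_in_carrier[of n p] by (auto simp: a_kernel_def' model_def)
  then show "I \<subseteq> a_kernel (free_algebra n) model normal_form"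
    unfolding skew_ideal_def
    by (intro ring.genideal_minimal[OF free_algebra_ring] ring_hom_ring.kernel_is_ideal[OF normal_form_hom])
qed

definition to_model :: "(nat list \<Rightarrow>\<^sub>0 'k) set \<Rightarrow> ((nat \<Rightarrow>\<^sub>0 nat) \<Rightarrow>\<^sub>0 'k)" where
  "to_model X = the_elem (normal_form ` X)"

lemma to_model_iso: "to_model \<in> ring_iso (skew_poly_ring n p) model"
  using ring_hom_ring.FactRing_iso_set[OF normal_form_hom normal_form_surj]
  unfolding kernel_normal_form skew_poly_ring_def to_model_def[abs_def] by simp

lemma to_model_coset:
  assumes "f \<in> carrier (free_algebra n)"
  shows "to_model (I +>\<^bsub>free_algebra n\<^esub> f) = normal_form f"
  using ring_hom_ring.the_elem_simp[OF normal_form_hom assms]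
  unfolding kernel_normal_form to_model_def .

lemma to_model_const: "to_model (skew_const n p c) = single 0 c"
  unfolding skew_const_def
  by (subst to_model_coset) (simp_all add: free_const_def free_algebra_def normal_form_def)

lemma to_model_var: "i \<in> {1..n} \<Longrightarrow> to_model (skew_var n p i) = single (single i 1) 1"
  unfolding skew_var_def
  by (subst to_model_coset) (simp_all add: free_var_def free_algebra_def normal_form_def)

lemma coset_in_quotient: "f \<in> carrier R \<Longrightarrow> J +>\<^bsub>R\<^esub> f \<in> carrier (R Quot J)"
  unfolding FactRing_def A_RCOSETS_def RCOSETS_def a_r_coset_def by simp blast

lemma skew_const_in_carrier: "skew_const n p c \<in> carrier (skew_poly_ring n p)"
  unfolding skew_const_def skew_poly_ring_def
  by (rule coset_in_quotient) (simp add: free_const_def free_algebra_def)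

lemma skew_var_in_carrier: "i \<in> {1..n} \<Longrightarrow> skew_var n p i \<in> carrier (skew_poly_ring n p)"
  unfolding skew_var_def skew_poly_ring_def
  by (rule coset_in_quotient) (simp add: free_var_def free_algebra_def)

end

section \<open>Transport of centers and polynomial presentations along isomorphisms\<close>

lemma ring_center_subset: "ring_center R \<subseteq> carrier R"
  unfolding ring_center_def by blast

lemma ring_iso_center:
  assumes R: "ring R" and \<phi>: "\<phi> \<in> ring_iso R S"
  shows "\<phi> \<in> ring_iso (R\<lparr>carrier := ring_center R\<rparr>) (S\<lparr>carrier := ring_center S\<rparr>)"
proof -
  note hom = ring_iso_memE(1-4)[OF \<phi>]
  have bij: "bij_betw \<phi> (carrier R) (carrier S)"
    by (rule ring_iso_memE(5)[OF \<phi>])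
  have "\<phi> ` ring_center R = ring_center S"
  proof
    show "\<phi> ` ring_center R \<subseteq> ring_center S"
    proof
      fix w assume "w \<in> \<phi> ` ring_center R"
      then obtain z where w: "w = \<phi> z" and zc: "z \<in> ring_center R"
        by blast
      from zc have z: "z \<in> carrier R"
        unfolding ring_center_def by simp
      have comm: "z \<otimes>\<^bsub>R\<^esub> r = r \<otimes>\<^bsub>R\<^esub> z" if "r \<in> carrier R" for r
        using zc that unfolding ring_center_def mem_Collect_eq by (elim conjE) (rule bspec)
      have "w \<otimes>\<^bsub>S\<^esub> s = s \<otimes>\<^bsub>S\<^esub> w" if "s \<in> carrier S" for s
      proof -
        have "s \<in> \<phi> ` carrier R"
          using that by (simp add: bij_betw_imp_surj_on[OF bij])
        then obtain r where "r \<in> carrier R" "s = \<phi> r"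
          by blast
        then show ?thesis
          using w comm[of r] hom(2)[OF z, of r] hom(2)[OF _ z, of r] by simp
      qed
      then show "w \<in> ring_center S"
        unfolding ring_center_def using w hom(1)[OF z] by simp
    qed
    show "ring_center S \<subseteq> \<phi> ` ring_center R"
    proof
      fix w assume w: "w \<in> ring_center S"
      then have "w \<in> \<phi> ` carrier R"
        unfolding bij_betw_imp_surj_on[OF bij] ring_center_def by simp
      then obtain z where z: "z \<in> carrier R" "w = \<phi> z"
        by blast
      have "z \<otimes>\<^bsub>R\<^esub> r = r \<otimes>\<^bsub>R\<^esub> z" if r: "r \<in> carrier R" for r
      proof (rule inj_onD[OF bij_betw_imp_inj_on[OF bij]])
        show "\<phi> (z \<otimes>\<^bsub>R\<^esub> r) = \<phi> (r \<otimes>\<^bsub>R\<^esub> z)"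
          using w z(2) hom(1)[OF r] unfolding ring_center_def
          by (simp add: hom(2)[OF z(1) r] hom(2)[OF r z(1)])
      qed (use z r monoid.m_closed[OF ring.is_monoid[OF R]] in simp_all)
      then show "w \<in> \<phi> ` ring_center R"
        unfolding ring_center_def using z by blast
    qed
  qed
  then have "bij_betw \<phi> (ring_center R) (ring_center S)"
    using inj_on_subset[OF bij_betw_imp_inj_on[OF bij], of "ring_center R"]
    by (simp add: bij_betw_def ring_center_subset)
  then show ?thesis
    by (intro ring_iso_memI)
      (simp_all add: bij_betw_apply hom subsetD[OF ring_center_subset])
qed

lemma is_polynomial_algebra_transfer:
  fixes \<eta> :: "'k::field \<Rightarrow> 'a"
  assumes \<phi>: "\<phi> \<in> ring_iso A B" and \<eta>: "\<And>c. \<phi> (\<eta> c) = \<theta> c"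
    and A: "is_polynomial_algebra A \<eta>"
  shows "is_polynomial_algebra B \<theta>"
proof -
  obtain m h where h: "h \<in> ring_iso (poly_ring m :: ((nat \<Rightarrow>\<^sub>0 nat) \<Rightarrow>\<^sub>0 'k) ring) A"
    "\<And>c. h (single 0 c) = \<eta> c"
    using A unfolding is_polynomial_algebra_def by blast
  then show ?thesis
    unfolding is_polynomial_algebra_def
    by (intro exI[of _ m] bexI[of _ "\<phi> \<circ> h"] ring_iso_set_trans[OF h(1) \<phi>]) (simp add: \<eta>)
qed

section \<open>The center in terms of exponent vectors\<close>

context skew
begin

text \<open>The product belonging to \<open>i\<close> is the scalar by which x^a x_i differs from
  x_i x^a, so this is the monoid H in multiplicative form.\<close>

definition central_exponents :: "(nat \<Rightarrow>\<^sub>0 nat) set" where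
  "central_exponents = {a \<in> exponents n. \<forall>i\<in>{1..n}. (\<Prod>j\<in>{1..n}. p i j ^ lookup a j) = 1}"

lemma central_exponents_subset: "central_exponents \<subseteq> exponents n"
  by (auto simp: central_exponents_def)

lemma central_exponents_zero [simp]: "0 \<in> central_exponents"
  by (simp add: central_exponents_def)

lemma central_exponents_add:
  "a \<in> central_exponents \<Longrightarrow> b \<in> central_exponents \<Longrightarrow> a + b \<in> central_exponents"
  by (simp add: central_exponents_def lookup_add power_add prod.distrib)

text \<open>Both sides are multiplicative in \<open>a\<close>, which leaves a power of one variable
  x_j; the three relative positions of \<open>i\<close> and \<open>j\<close> are then settled by
  antisymmetry of \<open>p\<close>.\<close>

lemma sig_commutation:
  assumes i: "i \<in> {1..n}" and a: "a \<in> exponents n"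
  shows "sig a (single i t) = sig (single i t) a * (\<Prod>j\<in>{1..n}. p i j ^ lookup a j) ^ t"
proof -
  from a have "keys a \<subseteq> {1..n}"
    by (simp add: exponents_def)
  then show ?thesis
  proof (induction a rule: poly_mapping_supp_induct)
    case (single j s)
    have "(\<Prod>j'\<in>{1..n}. p i j' ^ lookup (single j s) j') = (\<Prod>j'\<in>{1..n}. if j' = j then p i j ^ s else 1)"
      by (intro prod.cong refl) (simp add: lookup_single when_def)
    also have "\<dots> = p i j ^ s"
      using single by simp
    finally have prod: "(\<Prod>j'\<in>{1..n}. p i j' ^ lookup (single j s) j') = p i j ^ s" .
    consider "i < j" | "i = j" | "j < i"
      by linarith
    then show ?case
    proof cases
      case 1
      then show ?thesis
        unfolding prod using i single by (simp add: sig_single_single power_mult)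
    next
      case 2
      then show ?thesis
        unfolding prod using i by (simp add: p_diag sig_single_single)
    next
      case 3
      have "sig (single i t) (single j s) * (p i j ^ s) ^ t = (p i j * p j i) ^ (s * t)"
        using 3 i single by (simp add: sig_single_single power_mult_distrib power_mult mult.commute)
      then show ?thesis
        unfolding prod using 3 i single by (simp add: sig_single_single p_swap_mult)
    qed
  qed (simp_all add: sig_add_left sig_add_right lookup_add power_add prod.distrib power_mult_distrib)
qed

lemma sig_central:
  assumes a: "a \<in> central_exponents" and "b \<in> exponents n"
  shows "sig a b = sig b a"
proof -
  have "keys b \<subseteq> {1..n}"
    using assms by (simp add: exponents_def)
  then show ?thesis
  proof (induction b rule: poly_mapping_supp_induct)
    case (single i t)
    have "(\<Prod>j\<in>{1..n}. p i j ^ lookup a j) = 1"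
      using a single by (simp add: central_exponents_def)
    then show ?case
      using sig_commutation[OF single, of a t] a central_exponents_subset by auto
  qed (simp_all add: sig_add_left sig_add_right)
qed

lemma ring_center_model: "ring_center model = {f. keys f \<subseteq> central_exponents}"
proof (intro equalityI subsetI)
  fix f assume f: "f \<in> ring_center model"
  have "a \<in> central_exponents" if a: "a \<in> keys f" for a
  proof -
    have aE: "a \<in> exponents n"
      using f a by (auto simp: ring_center_def model_def)
    have "(\<Prod>j\<in>{1..n}. p i j ^ lookup a j) = 1" if i: "i \<in> {1..n}" for i
    proof -
      let ?e = "single i 1 :: nat \<Rightarrow>\<^sub>0 nat"
      \<comment> \<open>Commuting with x_i is tested coefficientwise: adding the exponent of x_i is
        injective, so each monomial of \<open>f\<close> is compared only with itself.\<close>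
      have "tmult sig f (single ?e 1) = tmult sig (single ?e 1) f"
        using f i by (simp add: ring_center_def model_def)
      then have eq: "lin (\<lambda>b. b + ?e) (\<lambda>b. sig b ?e * 1) f = lin (\<lambda>b. b + ?e) (\<lambda>b. sig ?e b * 1) f"
        unfolding tmult_single_left tmult_single_right add.commute[of ?e, abs_def] .
      have inj: "inj (\<lambda>b. b + ?e)"
        by (rule injI) simp
      from arg_cong[OF eq, of "\<lambda>g. lookup g (a + ?e)"]
      have "sig a ?e * lookup f a = sig ?e a * lookup f a"
        unfolding lookup_lin_inj[OF inj] by simp
      then have "sig a ?e = sig ?e a"
        using a by (simp add: in_keys_iff)
      then show ?thesis
        using sig_commutation[OF i aE, of 1] sig_nonzero[of ?e a] by simp
    qed
    then show ?thesis
      using aE by (simp add: central_exponents_def)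
  qed
  then show "f \<in> {f. keys f \<subseteq> central_exponents}"
    by blast
next
  fix f :: "(nat \<Rightarrow>\<^sub>0 nat) \<Rightarrow>\<^sub>0 'k"
  assume "f \<in> {f. keys f \<subseteq> central_exponents}"
  then have f: "keys f \<subseteq> central_exponents"
    by simp
  have "tmult sig f g = tmult sig g f" if g: "keys g \<subseteq> exponents n" for g
    using f
  proof (induction f rule: poly_mapping_supp_induct)
    case (single a x)
    from g show ?case
    proof (induction g rule: poly_mapping_supp_induct)
      case (single b y)
      then show ?case
        using \<open>a \<in> central_exponents\<close> by (simp add: sig_central[of a b] ac_simps)
    qed (simp_all add: tmult_add_left tmult_add_right)
  qed (simp_all add: tmult_add_left tmult_add_right)
  then show "f \<in> ring_center model"
    using f central_exponents_subset unfolding ring_center_def model_def by simp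
qed

definition model_center :: "((nat \<Rightarrow>\<^sub>0 nat) \<Rightarrow>\<^sub>0 'k) ring" where
  "model_center = \<lparr>carrier = {f. keys f \<subseteq> central_exponents},
     monoid.mult = tmult sig, one = 1, ring.zero = 0, ring.add = (+)\<rparr>"

lemma model_center_eq: "model\<lparr>carrier := ring_center model\<rparr> = model_center"
  unfolding ring_center_model by (simp add: model_def model_center_def)

lemma to_model_center_iso: "to_model \<in> ring_iso (skew_center n p) model_center"
  using ring_iso_center[OF skew_poly_ring_ring to_model_iso]
  unfolding skew_center_def model_center_eq .

lemma center_regular_iff_model:
  "center_regular n p \<longleftrightarrow> is_polynomial_algebra model_center (single 0 :: 'k \<Rightarrow> _)"
proof
  assume "center_regular n p"
  then show "is_polynomial_algebra model_center (single 0 :: 'k \<Rightarrow> _)"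
    unfolding center_regular_def
    by (rule is_polynomial_algebra_transfer[OF to_model_center_iso to_model_const])
next
  let ?\<psi> = "inv_into (carrier (skew_poly_ring n p)) to_model"
  have \<psi>: "?\<psi> \<in> ring_iso model (skew_poly_ring n p)"
    by (rule ring_iso_set_sym[OF skew_poly_ring_ring to_model_iso])
  have inj: "inj_on to_model (carrier (skew_poly_ring n p))"
    using ring_iso_memE(5)[OF to_model_iso] by (rule bij_betw_imp_inj_on)
  have const: "?\<psi> (single 0 c) = skew_const n p c" for c
    using inv_into_f_f[OF inj skew_const_in_carrier, of c] by (simp add: to_model_const)
  assume A: "is_polynomial_algebra model_center (single 0 :: 'k \<Rightarrow> _)"
  show "center_regular n p"
    unfolding center_regular_def skew_center_def
    by (rule is_polynomial_algebra_transfer[OF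
          ring_iso_center[OF model_ring \<psi>, unfolded model_center_eq] const A])
qed

end

subsection \<open>Homogeneous linear systems\<close>

text \<open>Elimination without division, by induction on the equations. Working over an integral
  domain allows both scalar and polynomial coefficients; both kinds occur below.\<close>

lemma nontrivial_solution:
  fixes M :: "'a \<Rightarrow> 'b \<Rightarrow> 'c::idom"
  assumes "finite J" "finite I" "card J < card I"
  obtains c where "\<exists>i\<in>I. c i \<noteq> 0" "\<And>j. j \<in> J \<Longrightarrow> (\<Sum>i\<in>I. c i * M i j) = 0"
proof -
  have "\<exists>c. (\<exists>i\<in>I. c i \<noteq> 0) \<and> (\<forall>j\<in>J. (\<Sum>i\<in>I. c i * M i j) = 0)"
    using assms
  proof (induction J arbitrary: I M rule: finite_induct)
    case empty
    then obtain i where "i \<in> I"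
      by fastforce
    then show ?case
      by (intro exI[of _ "\<lambda>_. 1"]) auto
  next
    case (insert j J)
    show ?case
    proof (cases "\<forall>i\<in>I. M i j = 0")
      case True
      moreover obtain c where "\<exists>i\<in>I. c i \<noteq> 0" "\<forall>j\<in>J. (\<Sum>i\<in>I. c i * M i j) = 0"
        using insert.IH[of I M] insert.prems insert.hyps by auto
      ultimately show ?thesis
        by (intro exI[of _ c]) simp
    next
      case False
      then obtain k where k: "k \<in> I" "M k j \<noteq> 0"
        by blast
      let ?I = "I - {k}"
      have "card J < card ?I"
        using insert.prems insert.hyps k by simp
      then obtain c where c: "\<exists>i\<in>?I. c i \<noteq> 0"
        and sol: "\<And>j'. j' \<in> J \<Longrightarrow> (\<Sum>i\<in>?I. c i * (M k j * M i j' - M i j * M k j')) = 0"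
        using insert.IH[of ?I "\<lambda>i j'. M k j * M i j' - M i j * M k j'"] insert.prems by auto
      \<comment> \<open>The other unknowns are scaled by the pivot \<open>M k j\<close>, and the
        unknown \<open>k\<close> is chosen so that equation \<open>j\<close> holds.\<close>
      define c' where "c' i = (if i = k then - (\<Sum>i\<in>?I. c i * M i j) else c i * M k j)" for i
      have sum: "(\<Sum>i\<in>I. c' i * M i j')
          = (\<Sum>i\<in>?I. c i * (M k j * M i j' - M i j * M k j'))" for j'
      proof -
        have "(\<Sum>i\<in>I. c' i * M i j') = c' k * M k j' + (\<Sum>i\<in>?I. c' i * M i j')"
          using k insert.prems by (simp add: sum.remove)
        also have "(\<Sum>i\<in>?I. c' i * M i j') = (\<Sum>i\<in>?I. c i * M k j * M i j')"
          by (intro sum.cong) (auto simp: c'_def)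
        also have "c' k * M k j' = - (\<Sum>i\<in>?I. c i * M i j * M k j')"
          by (simp add: c'_def sum_distrib_right)
        finally show ?thesis
          by (simp add: sum_subtractf right_diff_distrib mult.assoc)
      qed
      show ?thesis
      proof (intro exI[of _ c'] conjI ballI)
        show "\<exists>i\<in>I. c' i \<noteq> 0"
          using c k by (auto simp: c'_def)
        show "(\<Sum>i\<in>I. c' i * M i j') = 0" if "j' \<in> insert j J" for j'
          using that sol unfolding sum by (auto simp: mult.commute)
      qed
    qed
  qed
  with that show thesis
    by blast
qed

subsection \<open>Polynomial rings and their derivations\<close>

lemma carrier_poly_ring: "carrier (poly_ring m) = {f. keys f \<subseteq> exponents m}"
  by (auto simp: poly_ring_def exponents_def)

lemma poly_ring_ring: "ring (poly_ring m :: ((nat \<Rightarrow>\<^sub>0 nat) \<Rightarrow>\<^sub>0 'k::field) ring)"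
proof (rule ringI)
  show "abelian_group (poly_ring m :: ((nat \<Rightarrow>\<^sub>0 nat) \<Rightarrow>\<^sub>0 'k) ring)"
  proof (rule abelian_groupI)
    fix x y :: "(nat \<Rightarrow>\<^sub>0 nat) \<Rightarrow>\<^sub>0 'k"
    assume "x \<in> carrier (poly_ring m)" "y \<in> carrier (poly_ring m)"
    then show "x \<oplus>\<^bsub>poly_ring m\<^esub> y \<in> carrier (poly_ring m)"
      using keys_add[of x y] unfolding poly_ring_def by fastforce
  next
    fix x :: "(nat \<Rightarrow>\<^sub>0 nat) \<Rightarrow>\<^sub>0 'k"
    assume "x \<in> carrier (poly_ring m)"
    then show "\<exists>y\<in>carrier (poly_ring m). y \<oplus>\<^bsub>poly_ring m\<^esub> x = \<zero>\<^bsub>poly_ring m\<^esub>"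
      by (intro bexI[of _ "- x"]) (simp_all add: poly_ring_def)
  qed (simp_all add: poly_ring_def ac_simps)
  show "Group.monoid (poly_ring m :: ((nat \<Rightarrow>\<^sub>0 nat) \<Rightarrow>\<^sub>0 'k) ring)"
  proof (rule monoidI)
    fix x y :: "(nat \<Rightarrow>\<^sub>0 nat) \<Rightarrow>\<^sub>0 'k"
    assume "x \<in> carrier (poly_ring m)" "y \<in> carrier (poly_ring m)"
    then show "x \<otimes>\<^bsub>poly_ring m\<^esub> y \<in> carrier (poly_ring m)"
      using keys_tmult_exponents[of x m y "\<lambda>_ _. 1"]
      unfolding carrier_poly_ring tmult_eq_mult by (simp add: poly_ring_def)
  qed (simp_all add: poly_ring_def ac_simps)
qed (simp_all add: poly_ring_def algebra_simps)

text \<open>Generation of the polynomial ring by constants and variables, in the form that lets a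
  point derivation be controlled by its values on the variables.\<close>

lemma poly_ring_induct [consumes 1, case_names const var add mult]:
  fixes F :: "(nat \<Rightarrow>\<^sub>0 nat) \<Rightarrow>\<^sub>0 'k::field"
  assumes F: "F \<in> carrier (poly_ring m)"
    and const: "\<And>c. P (single 0 c)"
    and var: "\<And>i. i \<in> {1..m} \<Longrightarrow> P (single (single i 1) 1)"
    and add: "\<And>F G. F \<in> carrier (poly_ring m) \<Longrightarrow> G \<in> carrier (poly_ring m) \<Longrightarrow> P F \<Longrightarrow> P G \<Longrightarrow> P (F + G)"
    and mult: "\<And>F G. F \<in> carrier (poly_ring m) \<Longrightarrow> G \<in> carrier (poly_ring m) \<Longrightarrow> P F \<Longrightarrow> P G \<Longrightarrow> P (F * G)"
  shows "P F"
proof -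
  have monomial: "P (single u 1)" if "u \<in> exponents m" for u
  proof -
    from that have "keys u \<subseteq> {1..m}"
      by (simp add: exponents_def)
    then show ?thesis
    proof (induction u rule: poly_mapping_supp_induct)
      case zero
      show ?case
        by (rule const)
    next
      case (single i t)
      show ?case
      proof (induction t)
        case 0
        show ?case
          using const[of 1] by simp
      next
        case (Suc t)
        have "P (single (single i 1) 1 * single (single i t) 1)"
          using single Suc var by (intro mult) (simp_all add: carrier_poly_ring)
        then show ?case
          by (simp add: mult_single flip: single_add)
      qed
    next
      case (add u v)
      then have "P (single u 1 * single v 1)"
        by (intro mult) (simp_all add: carrier_poly_ring exponents_def)
      then show ?case
        by (simp add: mult_single)
    qed
  qed
  have "keys F \<subseteq> exponents m"
    using F by (simp add: carrier_poly_ring)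
  then show ?thesis
  proof (induction F rule: poly_mapping_supp_induct)
    case zero
    show ?case
      using const[of 0] by simp
  next
    case (single u c)
    then have "P (single 0 c * single u 1)"
      by (intro mult const monomial) (simp_all add: carrier_poly_ring)
    then show ?case
      by (simp add: mult_single)
  next
    case (add F G)
    then show ?case
      by (intro assms(4)) (simp_all add: carrier_poly_ring)
  qed
qed

text \<open>Subtraction of exponents is truncated at zero; where truncation occurs, the coefficient
  \<open>of_nat (lookup u i)\<close> is zero.\<close>

definition partial_deriv :: "nat \<Rightarrow> ((nat \<Rightarrow>\<^sub>0 nat) \<Rightarrow>\<^sub>0 'k) \<Rightarrow> ((nat \<Rightarrow>\<^sub>0 nat) \<Rightarrow>\<^sub>0 'k::field_char_0)" where
  "partial_deriv i = lin (\<lambda>u. u - single i 1) (\<lambda>u. of_nat (lookup u i))"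

lemma partial_deriv_mult: "partial_deriv i (f * g) = partial_deriv i f * g + f * partial_deriv i g"
proof (induction f rule: poly_mapping_single_induct)
  case (single u x)
  show ?case
  proof (induction g rule: poly_mapping_single_induct)
    case (single v y)
    let ?e = "single i 1 :: nat \<Rightarrow>\<^sub>0 nat"
    \<comment> \<open>If x_i does not occur in \<open>w\<close>, truncation may spoil the exponents,
      but then both coefficients are zero.\<close>
    have shift: "single (w - ?e + z) (of_nat (lookup w i) * c) = single (w + z - ?e) (of_nat (lookup w i) * c)"
      for w z :: "nat \<Rightarrow>\<^sub>0 nat" and c :: 'a
    proof (cases "lookup w i = 0")
      case False
      then have "w - ?e + z = w + z - ?e"
        by (intro poly_mapping_eqI) (auto simp: lookup_add lookup_minus lookup_single when_def)
      then show ?thesis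
        by simp
    qed simp
    have "partial_deriv i (single u x) * single v y + single u x * partial_deriv i (single v y)
        = single (u - ?e + v) (of_nat (lookup u i) * (x * y)) + single (v - ?e + u) (of_nat (lookup v i) * (x * y))"
      by (simp add: partial_deriv_def mult_single ac_simps)
    also have "\<dots> = single (u + v - ?e) (of_nat (lookup u i) * (x * y) + of_nat (lookup v i) * (x * y))"
      unfolding shift by (simp add: add.commute single_add)
    also have "\<dots> = partial_deriv i (single u x * single v y)"
      by (simp add: partial_deriv_def mult_single lookup_add distrib_right)
    finally show ?case ..
  qed (simp_all add: partial_deriv_def lin_add distrib_left)
qed (simp_all add: partial_deriv_def lin_add distrib_right)

lemma partial_deriv_add: "partial_deriv i (f + g) = partial_deriv i f + partial_deriv i g"
  by (simp add: partial_deriv_def lin_add)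

lemma partial_deriv_const [simp]: "partial_deriv i (single 0 c) = 0"
  by (simp add: partial_deriv_def)

lemma partial_deriv_var: "partial_deriv i (single (single j 1) 1) = (if i = j then 1 else 0)"
  by (auto simp: partial_deriv_def lookup_single when_def)

definition derivation :: "('a::comm_ring_1 \<Rightarrow> 'a) \<Rightarrow> bool" where
  "derivation D \<longleftrightarrow> (\<forall>f g. D (f + g) = D f + D g \<and> D (f * g) = D f * g + f * D g)"

lemma derivation_partial_deriv_sum: "derivation (\<lambda>f. \<Sum>i\<in>I. c i * partial_deriv i f)"
  by (simp add: derivation_def partial_deriv_add partial_deriv_mult distrib_left sum.distrib sum_distrib_left
      sum_distrib_right ac_simps)

lemma derivation_power:
  assumes "derivation D"
  shows "D (f ^ Suc k) = of_nat (Suc k) * f ^ k * D f"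
proof (induction k)
  case (Suc k)
  have "D (f ^ Suc (Suc k)) = D f * f ^ Suc k + f * D (f ^ Suc k)"
    using assms unfolding derivation_def by simp
  then show ?case
    unfolding Suc by (simp add: algebra_simps)
qed simp

subsection \<open>Orders of roots of unity\<close>

lemma power_eq_1_iff_root_order_dvd:
  assumes "root_of_unity x"
  shows "x ^ k = 1 \<longleftrightarrow> root_order x dvd k"
proof -
  let ?P = "\<lambda>d. d > 0 \<and> x ^ d = 1"
  have "?P (root_order x)"
    unfolding root_order_def by (rule LeastI_ex) (use assms in \<open>simp add: root_of_unity_def\<close>)
  then have pos: "root_order x > 0" and one: "x ^ root_order x = 1"
    by simp_all
  have least: "\<not> ?P d" if "d < root_order x" for d
    using not_less_Least[of d ?P] that unfolding root_order_def by blast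
  have "x ^ k = x ^ (root_order x * (k div root_order x) + k mod root_order x)"
    by simp
  also have "\<dots> = x ^ (k mod root_order x)"
    unfolding power_add power_mult one by simp
  finally show ?thesis
    using least[of "k mod root_order x"] pos by (auto simp: dvd_eq_mod_eq_0)
qed

lemma root_order_pos: "root_of_unity x \<Longrightarrow> root_order x > 0"
  using power_eq_1_iff_root_order_dvd[of x] unfolding root_of_unity_def
  by (metis dvd_pos_nat)

section \<open>The orders of the variables modulo the center\<close>

context skew
begin

text \<open>This is d_i: the powers of x_i that commute with x_j are those whose exponent is a
  multiple of the order of p_ji.\<close>

definition var_order :: "nat \<Rightarrow> nat" where
  "var_order i = Lcm ((\<lambda>j. root_order (p j i)) ` {1..n})"

lemma var_order_dvd_iff:
  assumes "i \<in> {1..n}"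
  shows "var_order i dvd t \<longleftrightarrow> (\<forall>j\<in>{1..n}. p j i ^ t = 1)"
  using roots assms by (simp add: var_order_def Lcm_dvd_iff power_eq_1_iff_root_order_dvd)

lemma var_order_pos:
  assumes "i \<in> {1..n}"
  shows "var_order i > 0"
proof -
  have "0 \<notin> (\<lambda>j. root_order (p j i)) ` {1..n}"
    using roots assms root_order_pos by fastforce
  then have "var_order i \<noteq> 0"
    unfolding var_order_def by (subst Lcm_0_iff) simp_all
  then show ?thesis
    by simp
qed

lemma single_central_iff:
  assumes i: "i \<in> {1..n}"
  shows "single i t \<in> central_exponents \<longleftrightarrow> var_order i dvd t"
proof -
  have "(\<Prod>j'\<in>{1..n}. p j j' ^ lookup (single i t) j') = p j i ^ t" for j
  proof -
    have "(\<Prod>j'\<in>{1..n}. p j j' ^ lookup (single i t) j') = (\<Prod>j'\<in>{1..n}. if j' = i then p j i ^ t else 1)"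
      by (intro prod.cong refl) (simp add: lookup_single when_def)
    then show ?thesis
      using i by simp
  qed
  then show ?thesis
    using i by (simp add: central_exponents_def var_order_dvd_iff)
qed

text \<open>Equivalent to H being freely generated by the vectors d_i e_i, since their multiples
  always lie in H.\<close>

definition separated :: bool where
  "separated \<longleftrightarrow> (\<forall>a\<in>central_exponents. \<forall>i\<in>{1..n}. var_order i dvd lookup a i)"

text \<open>Here \<open>lin\<close> acts on exponent vectors themselves, with natural numbers as
  scalars; it substitutes x_i^(d_i) for the i-th variable.\<close>

abbreviation dilate :: "(nat \<Rightarrow>\<^sub>0 nat) \<Rightarrow> (nat \<Rightarrow>\<^sub>0 nat)" where
  "dilate \<equiv> lin (\<lambda>i. i) var_order"

lemma lookup_dilate: "lookup (dilate u) i = var_order i * lookup u i"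
  by (rule lookup_lin_inj) (simp add: inj_def)

lemma dilate_central:
  assumes "u \<in> exponents n"
  shows "dilate u \<in> central_exponents"
proof -
  have "p i j ^ lookup (dilate u) j = 1" if "i \<in> {1..n}" "j \<in> {1..n}" for i j
    using that var_order_dvd_iff[of j "lookup (dilate u) j"] by (simp add: lookup_dilate)
  moreover have "dilate u \<in> exponents n"
    using assms keys_lin[of "\<lambda>i. i" var_order u] by (auto simp: exponents_def)
  ultimately show ?thesis
    by (simp add: central_exponents_def)
qed

text \<open>Powers of the elements x_j^(d_j) pass through all variables without a scalar, so on
  dilated exponents the twisted product is the ordinary one.\<close>

lemma sig_dilate: "sig (dilate u) b = 1"
  unfolding sig_def
proof (intro prod.neutral ballI)
  fix i j assume "i \<in> {1..n}" "j \<in> {i<..n}"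
  then have "p i j ^ var_order j = 1"
    using var_order_dvd_iff[of j "var_order j"] by auto
  then show "p i j ^ (lookup (dilate u) j * lookup b i) = 1"
    by (simp add: lookup_dilate power_mult)
qed

text \<open>The isomorphism sends the i-th variable to x_i^(d_i). It permits the number of variables
  to be \<open>n\<close>.\<close>

lemma separated_imp_polynomial:
  assumes separated
  shows "is_polynomial_algebra model_center (single 0 :: 'k \<Rightarrow> _)"
proof -
  let ?h = "lin dilate (\<lambda>_. 1) :: _ \<Rightarrow> ((nat \<Rightarrow>\<^sub>0 nat) \<Rightarrow>\<^sub>0 'k)"
  \<comment> \<open>Division of exponents by d_i; separation makes it inverse to dilation on central
    exponents.\<close>
  let ?con = "\<lambda>a. Poly_Mapping.mapp (\<lambda>i x. x div var_order i) a"
  let ?g = "lin ?con (\<lambda>_. 1) :: _ \<Rightarrow> ((nat \<Rightarrow>\<^sub>0 nat) \<Rightarrow>\<^sub>0 'k)"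
  have lookup_con: "lookup (?con a) i = lookup a i div var_order i" for a i
    by (simp add: lookup_mapp when_def in_keys_iff)
  have con_dilate: "?con (dilate u) = u" if u: "u \<in> exponents n" for u
  proof (rule poly_mapping_eqI)
    fix i show "lookup (?con (dilate u)) i = lookup u i"
      using var_order_pos[of i] exponents_eq_zero[OF u, of i]
      by (cases "i \<in> {1..n}") (simp_all add: lookup_con lookup_dilate)
  qed
  have dilate_con: "dilate (?con a) = a" if a: "a \<in> central_exponents" for a
  proof (rule poly_mapping_eqI)
    fix i
    have "i \<in> {1..n} \<Longrightarrow> var_order i dvd lookup a i"
      using assms a unfolding separated_def by blast
    then show "lookup (dilate (?con a)) i = lookup a i"
      using exponents_eq_zero[OF subsetD[OF central_exponents_subset a], of i]
      by (cases "i \<in> {1..n}") (simp_all add: lookup_con lookup_dilate)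
  qed
  have con_exponents: "?con a \<in> exponents n" if "a \<in> central_exponents" for a
    using that central_exponents_subset keys_mapp_subset[of _ a] unfolding exponents_def by blast
  have h_closed: "keys (?h f) \<subseteq> central_exponents" if "keys f \<subseteq> exponents n" for f
    using that keys_lin[of dilate "\<lambda>_. 1" f] dilate_central by blast
  have g_closed: "keys (?g f) \<subseteq> exponents n" if "keys f \<subseteq> central_exponents" for f
    using that keys_lin[of ?con "\<lambda>_. 1" f] con_exponents by blast
  have "?h \<in> ring_iso (poly_ring n) model_center"
  proof (rule ring_iso_memI)
    show "?h f \<in> carrier model_center" if "f \<in> carrier (poly_ring n)" for f
      using that h_closed by (simp add: carrier_poly_ring model_center_def)
    show "?h (f \<otimes>\<^bsub>poly_ring n\<^esub> g) = ?h f \<otimes>\<^bsub>model_center\<^esub> ?h g"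
      if "f \<in> carrier (poly_ring n)" "g \<in> carrier (poly_ring n)" for f g
    proof -
      have "?h (tmult (\<lambda>_ _. 1) f g) = tmult sig (?h f) (?h g)"
        by (rule lin_tmult[where A = UNIV]) (simp_all add: lin_add sig_dilate)
      then show ?thesis
        by (simp add: poly_ring_def model_center_def tmult_eq_mult)
    qed
    show "?h (f \<oplus>\<^bsub>poly_ring n\<^esub> g) = ?h f \<oplus>\<^bsub>model_center\<^esub> ?h g" for f g
      by (simp add: poly_ring_def model_center_def lin_add)
    show "?h \<one>\<^bsub>poly_ring n\<^esub> = \<one>\<^bsub>model_center\<^esub>"
      by (simp add: poly_ring_def model_center_def flip: single_one)
    show "bij_betw ?h (carrier (poly_ring n)) (carrier model_center)"
    proof (rule bij_betw_byWitness[where f' = ?g])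
      show "\<forall>f\<in>carrier (poly_ring n). ?g (?h f) = f"
      proof
        fix f :: "(nat \<Rightarrow>\<^sub>0 nat) \<Rightarrow>\<^sub>0 'k" assume "f \<in> carrier (poly_ring n)"
        then have "keys f \<subseteq> exponents n"
          by (simp add: carrier_poly_ring)
        then show "?g (?h f) = f"
          unfolding lin_lin by (intro lin_ident) (auto simp: con_dilate)
      qed
      show "\<forall>f\<in>carrier model_center. ?h (?g f) = f"
      proof
        fix f assume "f \<in> carrier model_center"
        then have "keys f \<subseteq> central_exponents"
          by (simp add: model_center_def)
        then show "?h (?g f) = f"
          unfolding lin_lin by (intro lin_ident) (auto simp: dilate_con)
      qed
    qed (use h_closed g_closed in \<open>auto simp: carrier_poly_ring model_center_def\<close>)
  qed
  then show ?thesis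
    unfolding is_polynomial_algebra_def by (intro exI[of _ n] bexI[of _ ?h]) simp_all
qed

end

subsection \<open>Regular centers\<close>

context skew
begin

definition irreducible_exponent :: "(nat \<Rightarrow>\<^sub>0 nat) \<Rightarrow> bool" where
  "irreducible_exponent a \<longleftrightarrow> a \<in> central_exponents \<and> a \<noteq> 0 \<and>
    (\<forall>b\<in>central_exponents. \<forall>c\<in>central_exponents. a = b + c \<longrightarrow> b = 0 \<or> c = 0)"

text \<open>Both summands of a decomposition are supported at \<open>i\<close>, hence multiples of
  d_i; two positive multiples already exceed d_i.\<close>

lemma irreducible_var:
  assumes i: "i \<in> {1..n}"
  shows "irreducible_exponent (single i (var_order i))"
  unfolding irreducible_exponent_def
proof (intro conjI ballI impI)
  show "single i (var_order i) \<in> central_exponents"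
    using single_central_iff[OF i] by simp
  have "lookup (single i (var_order i)) i \<noteq> 0"
    using var_order_pos[OF i] by simp
  then show "single i (var_order i) \<noteq> 0"
    by (metis lookup_zero)
next
  fix b c
  assume b: "b \<in> central_exponents" and c: "c \<in> central_exponents"
    and eq: "single i (var_order i) = b + c"
  have lookup_eq: "lookup b j + lookup c j = (if j = i then var_order i else 0)" for j
    using arg_cong[OF eq, of "\<lambda>u. lookup u j"] by (simp add: lookup_add lookup_single when_def split: if_splits)
  have zero: "lookup b j = 0" "lookup c j = 0" if "j \<noteq> i" for j
    using lookup_eq[of j] that by simp_all
  have "b = single i (lookup b i)" "c = single i (lookup c i)"
    by (intro poly_mapping_eqI; simp add: lookup_single when_def zero)+
  moreover have "var_order i dvd lookup b i" "var_order i dvd lookup c i"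
    using b c calculation single_central_iff[OF i] by metis+
  moreover have "lookup b i + lookup c i = var_order i"
    using lookup_eq[of i] by simp
  moreover have "lookup b i = 0 \<or> lookup c i = 0"
  proof (rule ccontr)
    assume "\<not> (lookup b i = 0 \<or> lookup c i = 0)"
    with calculation(3,4) have "var_order i \<le> lookup b i" "var_order i \<le> lookup c i"
      by (simp_all add: dvd_imp_le)
    with calculation(5) var_order_pos[OF i] show False
      by simp
  qed
  ultimately show "b = 0 \<or> c = 0"
    by (metis single_zero)
qed

text \<open>Take a violating vector of least total degree. If it were a sum of two nonzero central
  exponents, both would have smaller degree and satisfy the divisibilities, and so would their
  sum.\<close>

lemma exists_irreducible_not_separated:
  assumes "\<not> separated"
  obtains a where "irreducible_exponent a" "\<exists>i\<in>{1..n}. \<not> var_order i dvd lookup a i"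
proof -
  let ?bad = "\<lambda>a. a \<in> central_exponents \<and> (\<exists>i\<in>{1..n}. \<not> var_order i dvd lookup a i)"
  let ?size = "\<lambda>a :: nat \<Rightarrow>\<^sub>0 nat. \<Sum>i\<in>{1..n}. lookup a i"
  obtain a0 where a0: "?bad a0"
    using assms unfolding separated_def by blast
  define a where "a = arg_min ?size ?bad"
  have a: "?bad a" and least: "\<And>b. ?bad b \<Longrightarrow> ?size a \<le> ?size b"
    using arg_min_nat_lemma[of ?bad a0 ?size] a0 unfolding a_def by blast+
  have size_pos: "?size b > 0" if "b \<in> central_exponents" "b \<noteq> 0" for b
  proof (rule ccontr)
    assume "\<not> ?size b > 0"
    then have "lookup b i = 0" for i
      using exponents_eq_zero[OF subsetD[OF central_exponents_subset that(1)], of i] by auto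
    then have "b = 0"
      by (intro poly_mapping_eqI) simp
    with that show False
      by simp
  qed
  have "irreducible_exponent a"
    unfolding irreducible_exponent_def
  proof (intro conjI ballI impI)
    show "a \<in> central_exponents"
      using a by blast
    show "a \<noteq> 0"
      using a by auto
  next
    fix b c
    assume bc: "b \<in> central_exponents" "c \<in> central_exponents" "a = b + c"
    show "b = 0 \<or> c = 0"
    proof (rule ccontr)
      assume "\<not> (b = 0 \<or> c = 0)"
      then have "?size b > 0" "?size c > 0"
        using bc size_pos by blast+
      moreover have "?size a = ?size b + ?size c"
        by (simp add: bc(3) lookup_add sum.distrib)
      ultimately have "\<not> ?bad b" "\<not> ?bad c"
        using least[of b] least[of c] by linarith+
      with bc have "\<forall>i\<in>{1..n}. var_order i dvd lookup b i + lookup c i"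
        by (simp add: dvd_add)
      with a bc(3) show False
        by (simp add: lookup_add)
    qed
  qed
  with a that show thesis
    by blast
qed

end

section \<open>Consequences of a polynomial presentation of the center\<close>

locale regular_center = skew n p for n and p :: "nat \<Rightarrow> nat \<Rightarrow> 'k::field_char_0" +
  fixes m :: nat and h :: "((nat \<Rightarrow>\<^sub>0 nat) \<Rightarrow>\<^sub>0 'k) \<Rightarrow> ((nat \<Rightarrow>\<^sub>0 nat) \<Rightarrow>\<^sub>0 'k)"
  assumes h_iso: "h \<in> ring_iso (poly_ring m) model_center"
    and h_const: "\<And>c. h (single 0 c) = single 0 c"
begin

lemma h_closed: "F \<in> carrier (poly_ring m) \<Longrightarrow> keys (h F) \<subseteq> central_exponents"
  using ring_iso_memE(1)[OF h_iso, of F] by (simp add: model_center_def)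

lemma h_mult: "F \<in> carrier (poly_ring m) \<Longrightarrow> G \<in> carrier (poly_ring m) \<Longrightarrow> h (F * G) = tmult sig (h F) (h G)"
  using ring_iso_memE(2)[OF h_iso, of F G] by (simp add: model_center_def poly_ring_def)

lemma h_add: "F \<in> carrier (poly_ring m) \<Longrightarrow> G \<in> carrier (poly_ring m) \<Longrightarrow> h (F + G) = h F + h G"
  using ring_iso_memE(3)[OF h_iso, of F G] by (simp add: model_center_def poly_ring_def)

definition h_inv :: "((nat \<Rightarrow>\<^sub>0 nat) \<Rightarrow>\<^sub>0 'k) \<Rightarrow> ((nat \<Rightarrow>\<^sub>0 nat) \<Rightarrow>\<^sub>0 'k)" where
  "h_inv = inv_into (carrier (poly_ring m)) h"

lemma h_inv_iso: "h_inv \<in> ring_iso model_center (poly_ring m)"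
  unfolding h_inv_def by (rule ring_iso_set_sym[OF poly_ring_ring h_iso])

lemma h_inv_closed: "keys f \<subseteq> central_exponents \<Longrightarrow> h_inv f \<in> carrier (poly_ring m)"
  using ring_iso_memE(1)[OF h_inv_iso, of f] by (simp add: model_center_def)

lemma h_inv_mult: "keys f \<subseteq> central_exponents \<Longrightarrow> keys f' \<subseteq> central_exponents \<Longrightarrow> h_inv (tmult sig f f') = h_inv f * h_inv f'"
  using ring_iso_memE(2)[OF h_inv_iso, of f f'] by (simp add: model_center_def poly_ring_def)

lemma h_inv_add: "keys f \<subseteq> central_exponents \<Longrightarrow> keys f' \<subseteq> central_exponents \<Longrightarrow> h_inv (f + f') = h_inv f + h_inv f'"
  using ring_iso_memE(3)[OF h_inv_iso, of f f'] by (simp add: model_center_def poly_ring_def)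

lemma h_inv_h: "F \<in> carrier (poly_ring m) \<Longrightarrow> h_inv (h F) = F"
  unfolding h_inv_def by (rule inv_into_f_f[OF bij_betw_imp_inj_on[OF ring_iso_memE(5)[OF h_iso]]])

lemma h_h_inv:
  assumes "keys f \<subseteq> central_exponents"
  shows "h (h_inv f) = f"
  unfolding h_inv_def
proof (rule f_inv_into_f)
  show "f \<in> h ` carrier (poly_ring m)"
    unfolding bij_betw_imp_surj_on[OF ring_iso_memE(5)[OF h_iso]]
    using assms by (simp add: model_center_def)
qed

lemma h_inv_const: "h_inv (single 0 c) = single 0 c"
  using h_inv_h[of "single 0 c"] by (simp add: h_const carrier_poly_ring)

text \<open>With more irreducibles than variables, some nonzero combination \<open>\<Lambda>\<close>
  of the coefficients at the irreducibles vanishes on the images of all variables. As a point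
  derivation that also kills constants, it would vanish on the whole center.\<close>

lemma card_irreducible_le:
  assumes A: "finite A" and irr: "\<And>a. a \<in> A \<Longrightarrow> irreducible_exponent a"
  shows "card A \<le> m"
proof (rule ccontr)
  assume "\<not> card A \<le> m"
  then obtain \<phi> where \<phi>: "\<exists>a\<in>A. \<phi> a \<noteq> 0"
    and sol: "\<And>i. i \<in> {1..m} \<Longrightarrow> (\<Sum>a\<in>A. \<phi> a * lookup (h (single (single i 1) 1)) a) = 0"
    using nontrivial_solution[of "{1..m}" A "\<lambda>a i. lookup (h (single (single i 1) 1)) a"] A by auto
  define \<Lambda> where "\<Lambda> f = (\<Sum>a\<in>A. \<phi> a * lookup f a)" for f
  have zero_notin: "0 \<notin> A"
    using irr unfolding irreducible_exponent_def by blast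
  have \<Lambda>_add: "\<Lambda> (f + f') = \<Lambda> f + \<Lambda> f'" for f f'
    by (simp add: \<Lambda>_def lookup_add distrib_left sum.distrib)
  have \<Lambda>_single: "\<Lambda> (single b x) = (if b \<in> A then \<phi> b * x else 0)" for b x
  proof -
    have "\<Lambda> (single b x) = (\<Sum>a\<in>A. if a = b then \<phi> b * x else 0)"
      unfolding \<Lambda>_def by (intro sum.cong refl) (auto simp: lookup_single when_def)
    then show ?thesis
      using A by simp
  qed
  \<comment> \<open>Irreducibility makes \<open>\<Lambda>\<close> a point derivation at the augmentation.\<close>
  have \<Lambda>_mult: "\<Lambda> (tmult sig f f') = lookup f 0 * \<Lambda> f' + \<Lambda> f * lookup f' 0"
    if f: "keys f \<subseteq> central_exponents" and f': "keys f' \<subseteq> central_exponents" for f f'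
    using f
  proof (induction f rule: poly_mapping_supp_induct)
    case (single b x)
    from f' show ?case
    proof (induction f' rule: poly_mapping_supp_induct)
      case (single c y)
      have "b + c \<notin> A" if "b \<noteq> 0" "c \<noteq> 0"
        using irr[of "b + c"] that single \<open>b \<in> central_exponents\<close> unfolding irreducible_exponent_def by blast
      then show ?case
        using zero_notin by (cases "b = 0"; cases "c = 0") (simp_all add: \<Lambda>_single lookup_single)
    qed (simp_all add: tmult_add_right \<Lambda>_add lookup_add distrib_left distrib_right, simp add: \<Lambda>_def)
  qed (simp_all add: tmult_add_left \<Lambda>_add lookup_add distrib_left distrib_right, simp add: \<Lambda>_def)
  have vanish: "\<Lambda> (h F) = 0" if "F \<in> carrier (poly_ring m)" for F
    using that
  proof (induction F rule: poly_ring_induct)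
    case (const c)
    then show ?case
      using zero_notin by (simp add: h_const \<Lambda>_single)
  next
    case (var i)
    then show ?case
      using sol by (simp add: \<Lambda>_def)
  next
    case (add F G)
    then show ?case
      by (simp add: h_add \<Lambda>_add)
  next
    case (mult F G)
    then show ?case
      by (simp add: h_mult \<Lambda>_mult h_closed)
  qed
  \<comment> \<open>As \<open>h\<close> is onto, \<open>\<Lambda>\<close> vanishes on every central
    monomial, yet its value at x^a is \<open>\<phi> a\<close>.\<close>
  obtain a where a: "a \<in> A" "\<phi> a \<noteq> 0"
    using \<phi> by blast
  then have "keys (single a (1 :: 'k)) \<subseteq> central_exponents"
    using irr[of a] by (simp add: irreducible_exponent_def)
  then have "\<Lambda> (single a 1) = 0"
    using vanish[OF h_inv_closed] h_h_inv by metis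
  with a show False
    by (simp add: \<Lambda>_single)
qed

text \<open>The center is algebraic over the n elements x_j^N. A derivation killing these kills
  everything in characteristic 0, while for m > n a nonzero derivation killing them exists.\<close>

lemma generators_le: "m \<le> n"
proof (rule ccontr)
  assume "\<not> m \<le> n"
  \<comment> \<open>A common multiple of all d_i, so that every x_j^N is central.\<close>
  define N where "N = (\<Prod>i\<in>{1..n}. var_order i)"
  have N_pos: "N > 0"
    unfolding N_def using var_order_pos by (intro prod_pos) simp
  define u where "u j = h_inv (single (single j N) 1)" for j
  \<comment> \<open>The entries and the solution are polynomials: n linear conditions on m > n
    coefficients of a vector field.\<close>
  obtain c where c: "\<exists>i\<in>{1..m}. c i \<noteq> 0"
    and sol: "\<And>j. j \<in> {1..n} \<Longrightarrow> (\<Sum>i\<in>{1..m}. c i * partial_deriv i (u j)) = 0"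
    using nontrivial_solution[of "{1..n}" "{1..m}" "\<lambda>i j. partial_deriv i (u j)"] \<open>\<not> m \<le> n\<close> by auto
  define D where "D f = (\<Sum>i\<in>{1..m}. c i * partial_deriv i f)" for f
  have D: "derivation D"
    unfolding D_def[abs_def] by (rule derivation_partial_deriv_sum)
  have D_add: "D (f + f') = D f + D f'" and D_mult: "D (f * f') = D f * f' + f * D f'" for f f'
    using D unfolding derivation_def by blast+
  have D_const: "D (single 0 x) = 0" for x
    by (simp add: D_def)
  let ?w = "\<lambda>a. h_inv (single a 1)"
  \<comment> \<open>Multiplicativity of central monomials up to a nonzero constant, which
    \<open>D\<close> kills; so vanishing under \<open>D\<close> passes to sums of exponents.\<close>
  have w_add: "?w (a + b) = single 0 (inverse (sig a b)) * (?w a * ?w b)"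
    if "a \<in> central_exponents" "b \<in> central_exponents" for a b
  proof -
    have "?w (a + b) = h_inv (tmult sig (single 0 (inverse (sig a b))) (tmult sig (single a 1) (single b 1)))"
      using sig_nonzero[of a b] by simp
    also have "\<dots> = h_inv (single 0 (inverse (sig a b))) * h_inv (tmult sig (single a 1) (single b 1))"
      using that central_exponents_add[OF that] by (intro h_inv_mult) simp_all
    also have "h_inv (tmult sig (single a 1) (single b 1)) = ?w a * ?w b"
      using that by (intro h_inv_mult) simp_all
    finally show ?thesis
      by (simp add: h_inv_const)
  qed
  let ?Q = "\<lambda>b. b \<in> central_exponents \<and> D (?w b) = 0"
  have Q_zero: "?Q 0"
    by (simp only: h_inv_const D_const central_exponents_zero)
  have Q_add: "?Q (a + b)" if "?Q a" "?Q b" for a b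
    using that central_exponents_add[of a b] by (simp add: w_add D_mult D_const)
  have Q_var: "?Q (single j N)" if j: "j \<in> {1..n}" for j
  proof -
    have "var_order j dvd N"
      unfolding N_def using j by (intro dvd_prodI) simp_all
    then show ?thesis
      using sol[OF j] single_central_iff[OF j] by (simp add: D_def u_def)
  qed
  \<comment> \<open>The k-fold multiple of an exponent vector.\<close>
  let ?mult = "\<lambda>k. lin (\<lambda>i :: nat. i) (\<lambda>_. k :: nat)"
  have Q_multiple: "?Q (?mult N a)" if a: "a \<in> exponents n" for a
  proof -
    from a have "keys a \<subseteq> {1..n}"
      by (simp add: exponents_def)
    then show ?thesis
    proof (induction a rule: poly_mapping_supp_induct)
      case zero
      show ?case
        using Q_zero by simp
    next
      case (single j t)
      have "?Q (single j (N * t))"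
      proof (induction t)
        case 0
        show ?case
          using Q_zero by simp
      next
        case (Suc t)
        show ?case
          using Q_add[OF Q_var[OF single] Suc] by (simp flip: single_add)
      qed
      then show ?case
        by simp
    next
      case (add a b)
      show ?case
        using Q_add[OF add.IH] by (simp only: lin_add)
    qed
  qed
  have D_w: "D (?w a) = 0" if a: "a \<in> central_exponents" for a
  proof -
    \<comment> \<open>The N-th power of x^a is, up to a nonzero constant, a product of powers of the
      x_j^N. So \<open>D\<close> kills that power, and the power rule in a domain of characteristic
      0 lets the exponent be cancelled.\<close>
    have "?mult k a \<in> central_exponents \<and> (\<exists>\<kappa>. \<kappa> \<noteq> 0 \<and> ?w (?mult k a) = single 0 \<kappa> * ?w a ^ k)" for k
    proof (induction k)
      case 0
      have "?mult 0 a = 0"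
        by (simp add: lin_def)
      then show ?case
        using h_inv_const[of 1] by (intro conjI exI[of _ 1]) simp_all
    next
      case (Suc k)
      then obtain \<kappa> where \<kappa>: "?mult k a \<in> central_exponents" "\<kappa> \<noteq> 0" "?w (?mult k a) = single 0 \<kappa> * ?w a ^ k"
        by blast
      have step: "?mult (Suc k) a = ?mult k a + a"
        by (rule poly_mapping_eqI) (simp add: lookup_add lookup_lin_inj[of "\<lambda>i. i"] inj_def)
      show ?case
        unfolding step
        using \<kappa> a sig_nonzero[of "?mult k a" a]
        by (intro conjI central_exponents_add exI[of _ "inverse (sig (?mult k a) a) * \<kappa>"])
          (simp_all add: w_add mult_single mult.assoc[symmetric] power_commutes)
    qed
    then obtain \<kappa> where \<kappa>: "\<kappa> \<noteq> 0" "?w (?mult N a) = single 0 \<kappa> * ?w a ^ N"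
      by blast
    have "D (?w (?mult N a)) = 0"
      using Q_multiple a central_exponents_subset by blast
    then have "single 0 \<kappa> * D (?w a ^ N) = 0"
      by (simp add: \<kappa> D_mult D_const)
    moreover have "single 0 \<kappa> \<noteq> (0 :: (nat \<Rightarrow>\<^sub>0 nat) \<Rightarrow>\<^sub>0 'k)"
      using \<kappa>(1) by (metis lookup_single_eq lookup_zero)
    ultimately have "D (?w a ^ Suc (N - 1)) = 0"
      using N_pos by simp
    then have "of_nat (Suc (N - 1)) * ?w a ^ (N - 1) * D (?w a) = 0"
      unfolding derivation_power[OF D] .
    moreover have "?w a \<noteq> 0"
    proof
      assume "?w a = 0"
      then have "single a (1 :: 'k) = h 0"
        using h_h_inv[of "single a 1"] a by simp
      also have "h 0 = 0"
        using h_const[of 0] by simp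
      finally show False
        by (metis lookup_single_eq lookup_zero one_neq_zero)
    qed
    moreover have "of_nat (Suc (N - 1)) \<noteq> (0 :: (nat \<Rightarrow>\<^sub>0 nat) \<Rightarrow>\<^sub>0 'k)"
      by (rule of_nat_neq_0)
    ultimately show ?thesis
      by (simp only: mult_eq_0_iff power_eq_0_iff) simp
  qed
  have D_h_inv: "D (h_inv f) = 0" if "keys f \<subseteq> central_exponents" for f
    using that
  proof (induction f rule: poly_mapping_supp_induct)
    case zero
    show ?case
      using h_inv_const[of 0] D_const[of 0] by simp
  next
    case (single a x)
    have "h_inv (single a x) = h_inv (tmult sig (single 0 x) (single a 1))"
      by simp
    also have "\<dots> = single 0 x * ?w a"
      using single by (subst h_inv_mult) (simp_all add: h_inv_const)
    finally show ?case
      using single by (simp add: D_mult D_const D_w)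
  qed (simp add: h_inv_add D_add)
  have D_zero: "D F = 0" if "F \<in> carrier (poly_ring m)" for F
    using D_h_inv[OF h_closed[OF that]] h_inv_h[OF that] by simp
  obtain i where i: "i \<in> {1..m}" "c i \<noteq> 0"
    using c by blast
  \<comment> \<open>On a variable the vector field returns its coefficient, which was chosen
    nonzero.\<close>
  have "D (single (single i 1) 1) = (\<Sum>j\<in>{1..m}. if j = i then c j else 0)"
    unfolding D_def partial_deriv_var by (intro sum.cong) auto
  also have "\<dots> = c i"
    using i by simp
  finally show False
    using D_zero[of "single (single i 1) 1"] i by (simp add: carrier_poly_ring)
qed

text \<open>Failure of separation gives an irreducible besides the n vectors d_i e_i, hence n + 1
  irreducibles, against \<open>card_irreducible_le\<close> and \<open>generators_le\<close>.\<close>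

lemma separated: separated
proof (rule ccontr)
  assume "\<not> separated"
  then obtain a where a: "irreducible_exponent a" "\<exists>i\<in>{1..n}. \<not> var_order i dvd lookup a i"
    by (rule exists_irreducible_not_separated)
  let ?v = "\<lambda>i. single i (var_order i)"
  have inj: "inj_on ?v {1..n}"
  proof (rule inj_onI)
    fix i j assume "i \<in> {1..n}" "?v i = ?v j"
    then show "i = j"
      using var_order_pos[of i] by (metis lookup_single_eq lookup_single_not_eq less_irrefl)
  qed
  have "a \<notin> ?v ` {1..n}"
    using a(2) by (auto simp: lookup_single when_def split: if_splits)
  then have "card (insert a (?v ` {1..n})) = Suc n"
    using card_image[OF inj] by simp
  moreover have "card (insert a (?v ` {1..n})) \<le> m"
    using a irreducible_var by (intro card_irreducible_le) auto
  ultimately show False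
    using generators_le by simp
qed

end

theorem center_regular_iff_separated:
  fixes p :: "nat \<Rightarrow> nat \<Rightarrow> 'k::field_char_0"
  assumes "skew n p"
  shows "center_regular n p \<longleftrightarrow> skew.separated n p"
proof -
  interpret skew n p by fact
  show ?thesis
  proof
    assume "center_regular n p"
    then obtain m h where "h \<in> ring_iso (poly_ring m :: ((nat \<Rightarrow>\<^sub>0 nat) \<Rightarrow>\<^sub>0 'k) ring) model_center"
      "\<And>c. h (single 0 c) = single 0 c"
      unfolding center_regular_iff_model is_polynomial_algebra_def by blast
    then have "regular_center n p m h"
      by unfold_locales
    then show separated
      by (rule regular_center.separated)
  next
    assume separated
    then show "center_regular n p"
      unfolding center_regular_iff_model by (rule separated_imp_polynomial)
  qed
qed

subsection \<open>Kernels of skew-symmetric matrices modulo an integer\<close>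

text \<open>The additive form of \<open>separated\<close>. Only residues modulo \<open>L\<close>
  matter, so arbitrary integer vectors replace exponent vectors; the modulus is free because both
  \<ell> and \<rho> are used.\<close>

definition kernel_separated :: "nat \<Rightarrow> int \<Rightarrow> (nat \<Rightarrow> nat \<Rightarrow> int) \<Rightarrow> bool" where
  "kernel_separated n L b \<longleftrightarrow>
    (\<forall>x. (\<forall>i\<in>{1..n}. L dvd (\<Sum>j\<in>{1..n}. b i j * x j)) \<longrightarrow>
      (\<forall>i\<in>{1..n}. \<forall>j\<in>{1..n}. L dvd b i j * x j))"

lemma skew_symmetric_diag: "skew_symmetric n b \<Longrightarrow> i \<in> {1..n} \<Longrightarrow> b i i = 0"
  unfolding skew_symmetric_def by (drule conjunct1) (erule bspec)

lemma skew_symmetric_swap: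
  assumes "skew_symmetric n b" "i \<in> {1..n}" "j \<in> {1..n}"
  shows "b i j = - b j i"
  by (rule bspec[OF bspec[OF conjunct2[OF assms(1)[unfolded skew_symmetric_def]] assms(3)] assms(2)])

lemma dvd_of_coprime_multiples:
  fixes u v y L :: int
  assumes "coprime u v" "L dvd u * y" "L dvd v * y"
  shows "L dvd y"
proof -
  obtain s t where "s * u + t * v = gcd u v"
    using bezout_int by blast
  then have y: "(s * u + t * v) * y = y"
    using assms(1) by simp
  have "L dvd s * (u * y) + t * (v * y)"
    using dvd_add[OF dvd_mult[OF assms(2)] dvd_mult[OF assms(3)]] .
  also have "s * (u * y) + t * (v * y) = (s * u + t * v) * y"
    by (simp only: distrib_right mult.assoc)
  finally show ?thesis
    unfolding y .
qed

text \<open>Multiplying the sum by the product of the other orders kills all summands except the one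
  at \<open>j\<close>. That summand is also killed by its own order, and the two multipliers are
  coprime.\<close>

lemma dvd_summand_of_coprime_orders:
  fixes c x :: "'a \<Rightarrow> int" and d :: "'a \<Rightarrow> nat"
  assumes J: "finite J"
    and coprime: "\<And>j j'. j \<in> J \<Longrightarrow> j' \<in> J \<Longrightarrow> j \<noteq> j' \<Longrightarrow> coprime (d j) (d j')"
    and order: "\<And>j. j \<in> J \<Longrightarrow> L dvd c j * int (d j)"
    and sum: "L dvd (\<Sum>j\<in>J. c j * x j)" and j: "j \<in> J"
  shows "L dvd c j * x j"
proof -
  define M where "M = (\<Prod>j'\<in>J - {j}. int (d j'))"
  have "L dvd M * (c j' * x j')" if "j' \<in> J - {j}" for j'
  proof -
    have "M = int (d j') * (\<Prod>j''\<in>J - {j} - {j'}. int (d j''))"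
      unfolding M_def using J that by (intro prod.remove) auto
    then have "M * (c j' * x j') = (c j' * int (d j')) * ((\<Prod>j''\<in>J - {j} - {j'}. int (d j'')) * x j')"
      by (simp only: ac_simps)
    moreover have "L dvd c j' * int (d j')"
      using order that by blast
    ultimately show ?thesis
      by (metis dvd_mult2)
  qed
  then have "L dvd M * (\<Sum>j'\<in>J - {j}. c j' * x j')"
    unfolding sum_distrib_left by (intro dvd_sum)
  moreover have "L dvd M * (\<Sum>j\<in>J. c j * x j)"
    using sum by simp
  moreover have "M * (\<Sum>j\<in>J. c j * x j) = M * (c j * x j) + M * (\<Sum>j'\<in>J - {j}. c j' * x j')"
    unfolding distrib_left[symmetric] sum.remove[OF J j] ..
  ultimately have "L dvd M * (c j * x j)"
    by (simp only: dvd_add_left_iff)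
  moreover have "L dvd (c j * int (d j)) * x j"
    using order[OF j] by (rule dvd_mult2)
  then have "L dvd int (d j) * (c j * x j)"
    by (simp only: ac_simps)
  moreover have "coprime M (int (d j))"
    unfolding M_def using coprime j by (intro prod_coprime_left) auto
  ultimately show ?thesis
    by (metis dvd_of_coprime_multiples)
qed

text \<open>The preceding lemma is applied to each row of the matrix: the off-diagonal entries of
  one row belong to distinct unordered index pairs, so their orders are pairwise coprime.\<close>

lemma coprime_orders_imp_kernel_separated:
  assumes b: "skew_symmetric n b" and coprime: "orders_pairwise_coprime n q"
    and order: "\<And>i j. 1 \<le> i \<Longrightarrow> i < j \<Longrightarrow> j \<le> n \<Longrightarrow> L dvd b i j * int (root_order (q i j))"
  shows "kernel_separated n L b"
  unfolding kernel_separated_def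
proof (intro allI impI ballI)
  fix x i j
  assume ker: "\<forall>i\<in>{1..n}. L dvd (\<Sum>j\<in>{1..n}. b i j * x j)"
    and i: "i \<in> {1..n}" and j: "j \<in> {1..n}"
  \<comment> \<open>Coprimality speaks only of pairs in increasing order, so entries left of the
    diagonal use the transposed pair; the sign does not affect divisibility.\<close>
  define d where "d j = root_order (if i < j then q i j else q j i)" for j
  have diag: "b i i = 0"
    by (rule skew_symmetric_diag[OF b i])
  have "(\<Sum>j\<in>{1..n}. b i j * x j) = (\<Sum>j\<in>{1..n} - {i}. b i j * x j)"
    using sum.remove[OF finite_atLeastAtMost i, of "\<lambda>j. b i j * x j"] diag by simp
  then have sum: "L dvd (\<Sum>j\<in>{1..n} - {i}. b i j * x j)"
    using ker i by metis
  show "L dvd b i j * x j"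
  proof (cases "j = i")
    case True
    then show ?thesis
      using diag i by simp
  next
    case False
    show ?thesis
    proof (rule dvd_summand_of_coprime_orders[OF _ _ _ sum])
      show "coprime (d j) (d j')" if "j \<in> {1..n} - {i}" "j' \<in> {1..n} - {i}" "j \<noteq> j'" for j j'
      proof -
        define e where "e j = (if i < j then (i, j) else (j, i))" for j
        have "e j \<noteq> e j'" "e j \<in> {(i, j). 1 \<le> i \<and> i < j \<and> j \<le> n}" "e j' \<in> {(i, j). 1 \<le> i \<and> i < j \<and> j \<le> n}"
          using that i by (auto simp: e_def)
        from pairwiseD[OF coprime[unfolded orders_pairwise_coprime_def] this(2,3,1)]
        show ?thesis
          by (simp add: e_def d_def split: if_splits)
      qed
      show "L dvd b i j * int (d j)" if "j \<in> {1..n} - {i}" for j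
      proof (cases "i < j")
        case True
        then show ?thesis
          using that i order[of i j] by (simp add: d_def)
      next
        case False
        then have "L dvd b j i * int (d j)"
          using that i order[of j i] by (simp add: d_def)
        then show ?thesis
          unfolding skew_symmetric_swap[OF b i DiffD1[OF that]] by simp
      qed
    qed (use j False in auto)
  qed
qed

text \<open>By \<open>prod\<close>, each order divides every entry at another index pair. A common
  divisor of two different orders then divides all entries, since each entry sits away from at least
  one of the two pairs. It also divides \<open>L\<close>, so \<open>common\<close> applies.\<close>

lemma orders_pairwise_coprimeI:
  assumes b: "skew_symmetric n b"
    and order: "\<And>i j k. 1 \<le> i \<Longrightarrow> i < j \<Longrightarrow> j \<le> n \<Longrightarrow> root_order (q i j) dvd k \<longleftrightarrow> int L dvd b i j * int k"
    and common: "\<And>d. d dvd L \<Longrightarrow> \<forall>i\<in>{1..n}. \<forall>j\<in>{1..n}. int d dvd b i j \<Longrightarrow> d = 1"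
    and prod: "\<And>i j i' j'. 1 \<le> i \<Longrightarrow> i < j \<Longrightarrow> j \<le> n \<Longrightarrow> 1 \<le> i' \<Longrightarrow> i' < j' \<Longrightarrow> j' \<le> n \<Longrightarrow>
      (i, j) \<noteq> (i', j') \<Longrightarrow> int L dvd b i j * b i' j'"
  shows "orders_pairwise_coprime n q"
proof -
  have dvd: "int (root_order (q i j)) dvd b i' j'"
    if "1 \<le> i" "i < j" "j \<le> n" "1 \<le> i'" "i' < j'" "j' \<le> n" "(i, j) \<noteq> (i', j')" for i j i' j'
  proof -
    have "int L dvd b i j * int (nat \<bar>b i' j'\<bar>)"
      using prod[OF that] by (simp add: abs_if)
    then have "root_order (q i j) dvd nat \<bar>b i' j'\<bar>"
      using order[OF that(1-3)] by blast
    then have "int (root_order (q i j)) dvd int (nat \<bar>b i' j'\<bar>)"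
      by (simp only: int_dvd_int_iff)
    then show ?thesis
      by simp
  qed
  have "coprime (root_order (q i j)) (root_order (q i' j'))"
    if e: "1 \<le> i" "i < j" "j \<le> n" and f: "1 \<le> i'" "i' < j'" "j' \<le> n" and ne: "(i, j) \<noteq> (i', j')" for i j i' j'
  proof -
    let ?d = "gcd (root_order (q i j)) (root_order (q i' j'))"
    have "root_order (q i j) dvd L"
      using order[OF e, of L] by simp
    then have "?d dvd L"
      by (rule gcd_dvdI1)
    moreover have upper: "int ?d dvd b s t" if "1 \<le> s" "s < t" "t \<le> n" for s t
    proof (cases "(i, j) = (s, t)")
      case True
      then have "int (root_order (q i' j')) dvd b s t"
        using dvd[OF f that] ne by auto
      then show ?thesis
        by (metis dvd_trans gcd_dvd2 int_dvd_int_iff)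
    next
      case False
      then have "int (root_order (q i j)) dvd b s t"
        using dvd[OF e that] by auto
      then show ?thesis
        by (metis dvd_trans gcd_dvd1 int_dvd_int_iff)
    qed
    have "int ?d dvd b s t" if st: "s \<in> {1..n}" "t \<in> {1..n}" for s t
    proof -
      consider "s < t" | "s = t" | "t < s"
        by linarith
      then show ?thesis
      proof cases
        case 1
        then show ?thesis
          using upper[of s t] st by simp
      next
        case 2
        then show ?thesis
          using skew_symmetric_diag[OF b st(1)] by simp
      next
        case 3
        then have "int ?d dvd b t s"
          using upper[of t s] st by simp
        then show ?thesis
          unfolding skew_symmetric_swap[OF b st] by simp
      qed
    qed
    ultimately have "?d = 1"
      by (intro common ballI; simp)
    then show ?thesis
      by (simp add: coprime_iff_gcd_eq_1)
  qed
  then show ?thesis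
    unfolding orders_pairwise_coprime_def pairwise_def by auto
qed

section \<open>Test vectors in three and four variables\<close>

lemma Ball_atLeastAtMost_3: "(\<forall>i\<in>{1..3::nat}. P i) \<longleftrightarrow> P 1 \<and> P 2 \<and> P 3"
  and sum_atLeastAtMost_3: "(\<Sum>i\<in>{1..3::nat}. f i) = f 1 + f 2 + (f 3 :: int)"
proof -
  have "{1..3::nat} = {1, 2, 3}"
    by auto
  then show "(\<forall>i\<in>{1..3::nat}. P i) \<longleftrightarrow> P 1 \<and> P 2 \<and> P 3" "(\<Sum>i\<in>{1..3::nat}. f i) = f 1 + f 2 + f 3"
    by simp_all
qed

lemma Ball_atLeastAtMost_4: "(\<forall>i\<in>{1..4::nat}. P i) \<longleftrightarrow> P 1 \<and> P 2 \<and> P 3 \<and> P 4"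
  and sum_atLeastAtMost_4: "(\<Sum>i\<in>{1..4::nat}. f i) = f 1 + f 2 + f 3 + (f 4 :: int)"
proof -
  have "{1..4::nat} = {1, 2, 3, 4}"
    by auto
  then show "(\<forall>i\<in>{1..4::nat}. P i) \<longleftrightarrow> P 1 \<and> P 2 \<and> P 3 \<and> P 4"
    "(\<Sum>i\<in>{1..4::nat}. f i) = f 1 + f 2 + f 3 + f 4"
    by simp_all
qed

lemma kernel_separated_3_dvd:
  assumes b: "skew_symmetric 3 b" and sep: "kernel_separated 3 L b"
    and e: "1 \<le> i" "i < j" "j \<le> 3" and f: "1 \<le> i'" "i' < j'" "j' \<le> 3" and ne: "(i, j) \<noteq> (i', j')"
  shows "L dvd b i j * b i' j'"
proof -
  have skew: "b 1 1 = 0" "b 2 2 = 0" "b 3 3 = 0" "b 2 1 = - b 1 2" "b 3 1 = - b 1 3" "b 3 2 = - b 2 3"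
    by (rule skew_symmetric_diag[OF b] skew_symmetric_swap[OF b]; simp)+
  \<comment> \<open>This vector is annihilated by the matrix over the integers, and the summands of
    its rows are, up to sign, the products of two different entries.\<close>
  define x where "x = (\<lambda>i::nat. if i = 1 then b 2 3 else if i = 2 then - b 1 3 else b 1 2)"
  have x: "x 1 = b 2 3" "x 2 = - b 1 3" "x 3 = b 1 2"
    by (simp_all add: x_def)
  have "\<forall>i\<in>{1..3}. L dvd (\<Sum>j\<in>{1..3}. b i j * x j)"
    unfolding Ball_atLeastAtMost_3 sum_atLeastAtMost_3 x skew by simp
  then have "\<forall>i\<in>{1..3}. \<forall>j\<in>{1..3}. L dvd b i j * x j"
    using sep unfolding kernel_separated_def by blast
  then have "L dvd b 1 2 * b 1 3" "L dvd b 1 2 * b 2 3" "L dvd b 1 3 * b 2 3"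
    unfolding Ball_atLeastAtMost_3 x skew by (simp_all add: mult.commute)
  moreover have "(i, j) \<in> {(1, 2), (1, 3), (2, 3)}" "(i', j') \<in> {(1, 2), (1, 3), (2, 3)}"
    using e f by auto
  ultimately show ?thesis
    using ne by (auto simp: mult.commute)
qed

lemma skew_symmetric_4:
  assumes "skew_symmetric 4 b"
  shows "b 1 1 = 0" "b 2 2 = 0" "b 3 3 = 0" "b 4 4 = 0" "b 2 1 = - b 1 2" "b 3 1 = - b 1 3"
    "b 4 1 = - b 1 4" "b 3 2 = - b 2 3" "b 4 2 = - b 2 4" "b 4 3 = - b 3 4"
  by (rule skew_symmetric_diag[OF assms] skew_symmetric_swap[OF assms]; simp)+

text \<open>The vectors \<open>y\<close> below are the columns of the Pfaffian adjoint \<open>B\<^sup>*\<close>, for which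
  \<open>B B\<^sup>* = B\<^sup>* B = pf(B)\<close>.\<close>

lemma kernel_separated_4_dvd:
  assumes b: "skew_symmetric 4 b" and "L \<noteq> 0" and sep: "kernel_separated 4 L b"
    and e: "1 \<le> i" "i < j" "j \<le> 4" and f: "1 \<le> i'" "i' < j'" "j' \<le> 4" and ne: "(i, j) \<noteq> (i', j')"
  shows "gcd L (pfaffian4 b) dvd b i j * b i' j'"
proof -
  have edges: "(i, j) \<in> {(1, 2), (1, 3), (1, 4), (2, 3), (2, 4), (3, 4)}"
    if "1 \<le> i" "i < j" "j \<le> 4" for i j :: nat
  proof -
    have "i \<in> {1, 2, 3}" "j \<in> {2, 3, 4}"
      using that by auto
    then show ?thesis
      using that by auto
  qed
  note skew = skew_symmetric_4[OF b]
  let ?\<rho> = "gcd L (pfaffian4 b)"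
  obtain t where t: "L = ?\<rho> * t"
    by (rule dvdE[OF gcd_dvd1])
  obtain s where s: "pfaffian4 b = ?\<rho> * s"
    by (rule dvdE[OF gcd_dvd2])
  have "t \<noteq> 0"
    using t \<open>L \<noteq> 0\<close> by auto
  \<comment> \<open>A column \<open>y\<close> of the adjoint is sent to a multiple of a unit vector
    by the Pfaffian. Scaling by \<open>t\<close>, the quotient of \<open>L\<close> by the gcd, puts
    it into the kernel modulo \<open>L\<close>; separation applies, and \<open>t\<close> is
    cancelled again.\<close>
  have key: "?\<rho> dvd b i 1 * y1 \<and> ?\<rho> dvd b i 2 * y2 \<and> ?\<rho> dvd b i 3 * y3 \<and> ?\<rho> dvd b i 4 * y4"
    if i: "i \<in> {1..4}" and col: "\<forall>i\<in>{1..4}. b i 1 * y1 + b i 2 * y2 + b i 3 * y3 + b i 4 * y4 \<in> {0, pfaffian4 b}"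
    for i y1 y2 y3 y4
  proof -
    define x where "x = (\<lambda>i::nat. t * (if i = 1 then y1 else if i = 2 then y2 else if i = 3 then y3 else y4))"
    have x: "x 1 = t * y1" "x 2 = t * y2" "x 3 = t * y3" "x 4 = t * y4"
      by (simp_all add: x_def)
    have "L dvd (\<Sum>j\<in>{1..4}. b i j * x j)" if "i \<in> {1..4}" for i
    proof -
      have "t * pfaffian4 b = L * s"
        using t s by (metis mult.assoc mult.commute)
      then have "L dvd t * pfaffian4 b"
        by simp
      also have "t * pfaffian4 b dvd t * (b i 1 * y1 + b i 2 * y2 + b i 3 * y3 + b i 4 * y4)"
        using bspec[OF col that] by (intro mult_dvd_mono) auto
      also have "\<dots> = (\<Sum>j\<in>{1..4}. b i j * x j)"
        unfolding sum_atLeastAtMost_4 x by (simp add: algebra_simps)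
      finally show ?thesis .
    qed
    then have "\<forall>j\<in>{1..4}. ?\<rho> * t dvd b i j * x j"
      using sep i t unfolding kernel_separated_def by metis
    moreover have "?\<rho> dvd u * v" if "?\<rho> * t dvd u * (t * v)" for u v
    proof -
      have "?\<rho> * t dvd (u * v) * t"
        using that by (simp only: ac_simps)
      then show ?thesis
        using \<open>t \<noteq> 0\<close> by (simp only: dvd_mult_cancel_right) simp
    qed
    ultimately show ?thesis
      unfolding Ball_atLeastAtMost_4 x by blast
  qed
  have "\<forall>i\<in>{1..4}. b i 1 * 0 + b i 2 * b 3 4 + b i 3 * - b 2 4 + b i 4 * b 2 3 \<in> {0, pfaffian4 b}"
    "\<forall>i\<in>{1..4}. b i 1 * - b 3 4 + b i 2 * 0 + b i 3 * b 1 4 + b i 4 * - b 1 3 \<in> {0, pfaffian4 b}"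
    "\<forall>i\<in>{1..4}. b i 1 * b 2 4 + b i 2 * - b 1 4 + b i 3 * 0 + b i 4 * b 1 2 \<in> {0, pfaffian4 b}"
    "\<forall>i\<in>{1..4}. b i 1 * - b 2 3 + b i 2 * b 1 3 + b i 3 * - b 1 2 + b i 4 * 0 \<in> {0, pfaffian4 b}"
    unfolding Ball_atLeastAtMost_4 skew pfaffian4_def by (simp_all add: mult.commute)
  note cols = this[THEN key[rotated]]
  \<comment> \<open>The adjoint columns supply all fifteen products of two distinct entries.\<close>
  have "?\<rho> dvd b 1 2 * b 3 4" "?\<rho> dvd b 1 3 * b 2 4" "?\<rho> dvd b 1 4 * b 2 3"
    using cols(1)[of 1] by simp_all
  moreover have "?\<rho> dvd b 1 4 * b 1 3" "?\<rho> dvd b 1 4 * b 1 2" "?\<rho> dvd b 1 3 * b 1 2"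
    using cols(2-4)[of 1] by simp_all
  moreover have "?\<rho> dvd b 2 3 * b 2 4" "?\<rho> dvd b 1 2 * b 2 4" "?\<rho> dvd b 1 2 * b 2 3"
    using cols(1,3,4)[of 2] skew by simp_all
  moreover have "?\<rho> dvd b 2 3 * b 3 4" "?\<rho> dvd b 1 3 * b 3 4" "?\<rho> dvd b 1 3 * b 2 3"
    using cols(1,2,4)[of 3] skew by simp_all
  moreover have "?\<rho> dvd b 2 4 * b 3 4" "?\<rho> dvd b 1 4 * b 3 4" "?\<rho> dvd b 1 4 * b 2 4"
    using cols(1,2,3)[of 4] skew by simp_all
  moreover have "(i, j) \<in> {(1, 2), (1, 3), (1, 4), (2, 3), (2, 4), (3, 4)}"
    "(i', j') \<in> {(1, 2), (1, 3), (1, 4), (2, 3), (2, 4), (3, 4)}"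
    using edges[OF e] edges[OF f] by blast+
  ultimately show ?thesis
    using ne by (elim insertE emptyE) (simp_all add: mult.commute)
qed

text \<open>Applying the adjoint to a kernel vector \<open>x\<close> modulo \<open>L\<close> shows
  that \<open>L\<close> divides the Pfaffian times \<open>x\<close>. Hence x = t y with
  \<open>t\<close> the quotient of \<open>L\<close> by the gcd, and \<open>y\<close> is a kernel
  vector modulo the gcd. Separation there, multiplied by \<open>t\<close>, is separation modulo
  \<open>L\<close>.\<close>

lemma kernel_separated_4_lift:
  assumes b: "skew_symmetric 4 b" and "L \<noteq> 0" and sep: "kernel_separated 4 (gcd L (pfaffian4 b)) b"
  shows "kernel_separated 4 L b"
  unfolding kernel_separated_def
proof (intro allI impI)
  note skew = skew_symmetric_4[OF b]
  let ?\<rho> = "gcd L (pfaffian4 b)"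
  have "?\<rho> \<noteq> 0"
    using \<open>L \<noteq> 0\<close> by simp
  then obtain t s where t: "L = t * ?\<rho>" and s: "pfaffian4 b = s * ?\<rho>" and ts: "coprime t s"
    using gcd_coprime_exists[of L "pfaffian4 b"] by metis
  have "t \<noteq> 0"
    using t \<open>L \<noteq> 0\<close> by auto
  fix x :: "nat \<Rightarrow> int"
  assume ker: "\<forall>i\<in>{1..4}. L dvd (\<Sum>j\<in>{1..4}. b i j * x j)"
  define r where "r i = b i 1 * x 1 + b i 2 * x 2 + b i 3 * x 3 + b i 4 * x 4" for i
  have r: "L dvd r 1" "L dvd r 2" "L dvd r 3" "L dvd r 4"
    using ker unfolding Ball_atLeastAtMost_4 sum_atLeastAtMost_4 r_def by blast+
  \<comment> \<open>The coefficients of each line are a row of the Pfaffian adjoint.\<close>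
  have "pfaffian4 b * x 1 = - b 3 4 * r 2 + b 2 4 * r 3 - b 2 3 * r 4"
    "pfaffian4 b * x 2 = b 3 4 * r 1 - b 1 4 * r 3 + b 1 3 * r 4"
    "pfaffian4 b * x 3 = - b 2 4 * r 1 + b 1 4 * r 2 - b 1 2 * r 4"
    "pfaffian4 b * x 4 = b 2 3 * r 1 - b 1 3 * r 2 + b 1 2 * r 3"
    unfolding r_def skew pfaffian4_def by (simp_all add: algebra_simps)
  then have "\<forall>i\<in>{1..4}. L dvd pfaffian4 b * x i"
    unfolding Ball_atLeastAtMost_4 using r by simp
  have t_dvd: "t dvd x i" if "i \<in> {1..4}" for i
  proof -
    have "t * ?\<rho> dvd (s * x i) * ?\<rho>"
      using \<open>\<forall>i\<in>{1..4}. L dvd pfaffian4 b * x i\<close> that t s by (metis mult.assoc mult.commute)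
    then have "t dvd s * x i"
      using \<open>?\<rho> \<noteq> 0\<close> by (simp only: dvd_mult_cancel_right) simp
    then show ?thesis
      using ts by (simp add: coprime_dvd_mult_right_iff)
  qed
  define y where "y i = x i div t" for i
  have x: "x i = t * y i" if "i \<in> {1..4}" for i
    using t_dvd[OF that] by (simp add: y_def)
  have "\<forall>i\<in>{1..4}. ?\<rho> dvd (\<Sum>j\<in>{1..4}. b i j * y j)"
  proof
    fix i :: nat assume "i \<in> {1..4}"
    then have "L dvd (\<Sum>j\<in>{1..4}. b i j * x j)"
      using ker by blast
    also have "(\<Sum>j\<in>{1..4}. b i j * x j) = t * (\<Sum>j\<in>{1..4}. b i j * y j)"
      unfolding sum_distrib_left by (intro sum.cong) (simp_all add: x)
    finally have "t * ?\<rho> dvd t * (\<Sum>j\<in>{1..4}. b i j * y j)"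
      using t by metis
    then show "?\<rho> dvd (\<Sum>j\<in>{1..4}. b i j * y j)"
      using \<open>t \<noteq> 0\<close> by (simp only: dvd_mult_cancel_left) simp
  qed
  then have y: "\<forall>i\<in>{1..4}. \<forall>j\<in>{1..4}. ?\<rho> dvd b i j * y j"
    using sep unfolding kernel_separated_def by blast
  show "\<forall>i\<in>{1..4}. \<forall>j\<in>{1..4}. L dvd b i j * x j"
  proof (intro ballI)
    fix i j :: nat assume ij: "i \<in> {1..4}" "j \<in> {1..4}"
    then have "t * ?\<rho> dvd t * (b i j * y j)"
      using y by (intro mult_dvd_mono) auto
    also have "t * (b i j * y j) = b i j * x j"
      using ij x by simp
    finally show "L dvd b i j * x j"
      using t by metis
  qed
qed

subsection \<open>Exponent matrices\<close>

lemma primitive_root_power_int_eq_1_iff: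
  assumes "primitive_root_of_unity l \<xi>"
  shows "\<xi> powi z = 1 \<longleftrightarrow> int l dvd z"
proof -
  have \<xi>: "root_of_unity \<xi>" "root_order \<xi> = l"
    using assms by (simp_all add: primitive_root_of_unity_def)
  have "\<xi> powi z = 1 \<longleftrightarrow> \<xi> ^ nat \<bar>z\<bar> = 1"
    by (cases "z \<ge> 0") (simp_all add: power_int_def power_inverse)
  also have "\<dots> \<longleftrightarrow> int l dvd \<bar>z\<bar>"
    unfolding power_eq_1_iff_root_order_dvd[OF \<xi>(1)] \<xi>(2) by (simp flip: int_dvd_int_iff)
  finally show ?thesis
    by simp
qed

lemma root_order_eqI:
  assumes "root_of_unity x" "\<And>k. x ^ k = 1 \<longleftrightarrow> l dvd k"
  shows "root_order x = l"
  using power_eq_1_iff_root_order_dvd[OF assms(1)] assms(2) by (metis dvd_antisym dvd_refl)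

lemma primitive_root_pos: "primitive_root_of_unity l \<xi> \<Longrightarrow> l > 0"
  using root_order_pos by (auto simp: primitive_root_of_unity_def)

lemma primitive_root_nonzero: "primitive_root_of_unity l \<xi> \<Longrightarrow> \<xi> \<noteq> 0"
  by (auto simp: primitive_root_of_unity_def root_of_unity_def zero_power)

text \<open>Otherwise \<xi>^d, of order l/d, together with the matrix b/d would represent the same
  \<open>p\<close> with a smaller order.\<close>

lemma minimal_exponent_data_common_divisor:
  assumes "minimal_exponent_data n p l \<xi> b" and d: "d dvd l" "\<forall>i\<in>{1..n}. \<forall>j\<in>{1..n}. int d dvd b i j"
  shows "d = 1"
proof -
  have \<xi>: "primitive_root_of_unity l \<xi>" and b: "skew_symmetric n b"
    and p: "\<And>i j. i \<in> {1..n} \<Longrightarrow> j \<in> {1..n} \<Longrightarrow> p i j = \<xi> powi b i j"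
    and minimal: "\<And>l' \<xi>' b'. exponent_data n p l' \<xi>' b' \<Longrightarrow> l \<le> l'"
    using assms(1) unfolding minimal_exponent_data_def exponent_data_def by blast+
  have l: "l > 0"
    by (rule primitive_root_pos[OF \<xi>])
  then have "d > 0"
    using d(1) by (rule dvd_pos_nat)
  define l' where "l' = l div d"
  have l_eq: "l = d * l'"
    using d(1) by (simp add: l'_def)
  have "l' > 0"
    using l l_eq by simp
  have power: "(\<xi> ^ d) ^ k = 1 \<longleftrightarrow> l' dvd k" for k
  proof -
    have "(\<xi> ^ d) ^ k = 1 \<longleftrightarrow> \<xi> powi int (d * k) = 1"
      by (simp only: power_int_of_nat power_mult)
    also have "\<dots> \<longleftrightarrow> d * l' dvd d * k"
      unfolding primitive_root_power_int_eq_1_iff[OF \<xi>] l_eq by (simp only: int_dvd_int_iff)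
    finally show ?thesis
      using \<open>d > 0\<close> by simp
  qed
  have "(\<xi> ^ d) ^ l' = 1"
    by (simp only: power dvd_refl)
  then have root: "root_of_unity (\<xi> ^ d)"
    unfolding root_of_unity_def using \<open>l' > 0\<close> by blast
  then have "primitive_root_of_unity l' (\<xi> ^ d)"
    unfolding primitive_root_of_unity_def using root_order_eqI[OF root power] by simp
  moreover have "skew_symmetric n (\<lambda>i j. b i j div int d)"
    unfolding skew_symmetric_def
  proof (intro conjI ballI)
    fix i j assume ij: "i \<in> {1..n}" "j \<in> {1..n}"
    have "int d dvd b i j"
      using d(2) ij by blast
    then show "b j i div int d = - (b i j div int d)"
      unfolding skew_symmetric_swap[OF b ij(2,1)] by (rule dvd_neg_div)
  qed (simp add: skew_symmetric_diag[OF b])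
  moreover have "p i j = (\<xi> ^ d) powi (b i j div int d)" if "i \<in> {1..n}" "j \<in> {1..n}" for i j
  proof -
    have "b i j = int d * (b i j div int d)"
      using d(2) that by simp
    then have "\<xi> powi b i j = (\<xi> powi int d) powi (b i j div int d)"
      by (metis power_int_mult)
    then show ?thesis
      using p[OF that] by simp
  qed
  ultimately have "exponent_data n p l' (\<xi> ^ d) (\<lambda>i j. b i j div int d)"
    unfolding exponent_data_def by blast
  then have "d * l' \<le> 1 * l'"
    using minimal l_eq by simp
  then show ?thesis
    using \<open>d > 0\<close> \<open>l' > 0\<close> by simp
qed

section \<open>Regularity criteria from the exponent matrix\<close>

locale skew_exponents = skew n p for n and p :: "nat \<Rightarrow> nat \<Rightarrow> 'k::field_char_0" +
  fixes l :: nat and \<xi> :: 'k and b :: "nat \<Rightarrow> nat \<Rightarrow> int"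
  assumes minimal: "minimal_exponent_data n p l \<xi> b"
begin

lemma primitive: "primitive_root_of_unity l \<xi>" and b_skew: "skew_symmetric n b"
  and p_eq: "i \<in> {1..n} \<Longrightarrow> j \<in> {1..n} \<Longrightarrow> p i j = \<xi> powi b i j"
  using minimal unfolding minimal_exponent_data_def exponent_data_def by blast+

lemma p_power_eq_1_iff:
  assumes "i \<in> {1..n}" "j \<in> {1..n}"
  shows "p i j ^ k = 1 \<longleftrightarrow> int l dvd b i j * int k"
proof -
  have "p i j ^ k = \<xi> powi (b i j * int k)"
    by (simp only: p_eq[OF assms] power_int_mult power_int_of_nat)
  then show ?thesis
    by (simp only: primitive_root_power_int_eq_1_iff[OF primitive])
qed

lemma central_exponents_iff:
  "a \<in> central_exponents \<longleftrightarrow>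
    a \<in> exponents n \<and> (\<forall>i\<in>{1..n}. int l dvd (\<Sum>j\<in>{1..n}. b i j * int (lookup a j)))"
proof -
  have "(\<Prod>j\<in>{1..n}. p i j ^ lookup a j) = \<xi> powi (\<Sum>j\<in>{1..n}. b i j * int (lookup a j))"
    if i: "i \<in> {1..n}" for i
  proof -
    have "(\<Prod>j\<in>J. p i j ^ lookup a j) = \<xi> powi (\<Sum>j\<in>J. b i j * int (lookup a j))"
      if "finite J" "J \<subseteq> {1..n}" for J
      using that
    proof (induction J rule: finite_induct)
      case (insert j J)
      have "p i j ^ lookup a j = \<xi> powi (b i j * int (lookup a j))"
        using insert.prems by (simp only: p_eq[OF i] insert_subset power_int_mult power_int_of_nat)
      then show ?case
        using insert primitive_root_nonzero[OF primitive] by (simp add: power_int_add)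
    qed simp
    then show ?thesis
      by simp
  qed
  then show ?thesis
    by (simp add: central_exponents_def primitive_root_power_int_eq_1_iff[OF primitive])
qed

lemma separated_iff_kernel_separated: "separated \<longleftrightarrow> kernel_separated n (int l) b"
proof
  assume sep: separated
  show "kernel_separated n (int l) b"
    unfolding kernel_separated_def
  proof (intro allI impI ballI)
    fix x i j
    assume ker: "\<forall>i\<in>{1..n}. int l dvd (\<Sum>j\<in>{1..n}. b i j * x j)"
      and i: "i \<in> {1..n}" and j: "j \<in> {1..n}"
    \<comment> \<open>Least nonnegative residues turn the integer vector into an exponent vector
      without changing any product modulo \<ell>.\<close>
    define a where "a = (\<Sum>j\<in>{1..n}. single j (nat (x j mod int l)))"
    have l: "int l > 0"
      using primitive_root_pos[OF primitive] by simp
    have lookup_a: "lookup a j = (if j \<in> {1..n} then nat (x j mod int l) else 0)" for j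
      by (simp add: a_def lookup_sum lookup_single when_def)
    have diff: "int l dvd b i j * x j - b i j * int (lookup a j)" if "j \<in> {1..n}" for i j
    proof -
      have "int l dvd x j - x j mod int l"
        by (rule dvd_minus_mod)
      then show ?thesis
        using that l by (simp add: lookup_a flip: right_diff_distrib)
    qed
    have "a \<in> exponents n"
      unfolding exponents_def by (auto simp: in_keys_iff lookup_a split: if_splits)
    moreover have "int l dvd (\<Sum>j\<in>{1..n}. b i j * int (lookup a j))" if "i \<in> {1..n}" for i
    proof -
      have "int l dvd (\<Sum>j\<in>{1..n}. b i j * x j - b i j * int (lookup a j))"
        by (intro dvd_sum diff)
      then have "int l dvd (\<Sum>j\<in>{1..n}. b i j * x j) - (\<Sum>j\<in>{1..n}. b i j * int (lookup a j))"
        by (simp only: sum_subtractf)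
      then show ?thesis
        using ker that by (metis dvd_diff_right_iff)
    qed
    ultimately have "a \<in> central_exponents"
      by (simp add: central_exponents_iff)
    then have "int l dvd b i j * int (lookup a j)"
      using sep i j var_order_dvd_iff[OF j] p_power_eq_1_iff[OF i j] unfolding separated_def by blast
    then show "int l dvd b i j * x j"
      using diff[OF j, of i] by (metis dvd_diff_left_iff)
  qed
next
  assume sep: "kernel_separated n (int l) b"
  show separated
    unfolding separated_def
  proof (intro ballI)
    fix a i assume "a \<in> central_exponents" and i: "i \<in> {1..n}"
    then have "\<forall>i\<in>{1..n}. \<forall>j\<in>{1..n}. int l dvd b i j * int (lookup a j)"
      using sep[unfolded kernel_separated_def, THEN spec, of "\<lambda>j. int (lookup a j)"]
      unfolding central_exponents_iff by blast
    then show "var_order i dvd lookup a i"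
      unfolding var_order_dvd_iff[OF i] using i p_power_eq_1_iff by blast
  qed
qed

lemma center_regular_iff: "center_regular n p \<longleftrightarrow> kernel_separated n (int l) b"
  by (simp add: center_regular_iff_separated[OF skew_axioms] separated_iff_kernel_separated)

lemma root_order_p_dvd_iff:
  assumes "i \<in> {1..n}" "j \<in> {1..n}"
  shows "root_order (p i j) dvd k \<longleftrightarrow> int l dvd b i j * int k"
proof -
  have "root_of_unity (p i j)"
    using roots assms by blast
  then show ?thesis
    by (simp only: p_power_eq_1_iff[OF assms] flip: power_eq_1_iff_root_order_dvd)
qed

lemma coprime_orders_imp_center_regular:
  assumes "orders_pairwise_coprime n p"
  shows "center_regular n p"
  unfolding center_regular_iff
  using b_skew assms
proof (rule coprime_orders_imp_kernel_separated)
  fix i j assume "1 \<le> i" "i < j" "j \<le> n"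
  then show "int l dvd b i j * int (root_order (p i j))"
    using root_order_p_dvd_iff[of i j "root_order (p i j)"] by simp
qed

lemma center_regular_3_iff:
  assumes n: "n = 3"
  shows "center_regular n p \<longleftrightarrow> orders_pairwise_coprime n p"
proof
  assume "center_regular n p"
  then have sep: "kernel_separated 3 (int l) b"
    unfolding center_regular_iff unfolding n .
  show "orders_pairwise_coprime n p"
    using b_skew
  proof (rule orders_pairwise_coprimeI)
    show "root_order (p i j) dvd k \<longleftrightarrow> int l dvd b i j * int k" if "1 \<le> i" "i < j" "j \<le> n" for i j k
      using that by (intro root_order_p_dvd_iff) auto
    show "d = 1" if "d dvd l" "\<forall>i\<in>{1..n}. \<forall>j\<in>{1..n}. int d dvd b i j" for d
      using minimal that by (rule minimal_exponent_data_common_divisor)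
    show "int l dvd b i j * b i' j'"
      if "1 \<le> i" "i < j" "j \<le> n" "1 \<le> i'" "i' < j'" "j' \<le> n" "(i, j) \<noteq> (i', j')" for i j i' j'
      using kernel_separated_3_dvd[OF b_skew[unfolded n] sep] that unfolding n by blast
  qed
qed (rule coprime_orders_imp_center_regular)

lemma center_regular_4_iff:
  assumes n: "n = 4" and \<rho>: "\<rho> = nat (gcd (int l) (pfaffian4 b))"
    and \<omega>: "primitive_root_of_unity \<rho> \<omega>"
  shows "center_regular n p \<longleftrightarrow>
    orders_pairwise_coprime n (\<lambda>i j. (\<omega> :: 'k) ^ nat (gcd (b i j) (int \<rho>)))"
proof -
  let ?q = "\<lambda>i j. \<omega> ^ nat (gcd (b i j) (int \<rho>))"
  have \<rho>_int: "int \<rho> = gcd (int l) (pfaffian4 b)"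
    using \<rho> by simp
  have l: "int l \<noteq> 0"
    using primitive_root_pos[OF primitive] by simp
  \<comment> \<open>Replacing \<open>b i j\<close> by its gcd with \<rho> does not change the order
    of the power of \<omega>. So the q_ij relate to \<rho> as the p_ij relate to \<ell>.\<close>
  have order: "root_order (?q i j) dvd k \<longleftrightarrow> int \<rho> dvd b i j * int k" for i j k
  proof -
    let ?c = "nat (gcd (b i j) (int \<rho>))"
    have power: "\<omega> ^ k = 1 \<longleftrightarrow> \<rho> dvd k" for k
      using power_eq_1_iff_root_order_dvd[of \<omega> k] \<omega> by (simp add: primitive_root_of_unity_def)
    have "(?q i j) ^ \<rho> = 1"
      unfolding power_mult[symmetric] power by simp
    then have "root_of_unity (?q i j)"
      using primitive_root_pos[OF \<omega>] unfolding root_of_unity_def by blast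
    then have "root_order (?q i j) dvd k \<longleftrightarrow> \<rho> dvd ?c * k"
      using power_eq_1_iff_root_order_dvd[of "?q i j" k] unfolding power_mult[symmetric] power by simp
    also have "\<dots> \<longleftrightarrow> int \<rho> dvd gcd (b i j) (int \<rho>) * int k"
      by (simp flip: int_dvd_int_iff)
    also have "\<dots> \<longleftrightarrow> int \<rho> dvd gcd (int k * b i j) (int k * int \<rho>)"
      using gcd_mult_distrib_int[of "int k" "b i j" "int \<rho>"] by (simp only: abs_of_nat mult.commute)
    also have "\<dots> \<longleftrightarrow> int \<rho> dvd b i j * int k"
      by (simp only: gcd_greatest_iff dvd_triv_right mult.commute) simp
    finally show ?thesis .
  qed
  have b4: "skew_symmetric 4 b"
    using b_skew unfolding n .
  show ?thesis
  proof
    assume "center_regular n p"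
    then have sep: "kernel_separated 4 (int l) b"
      unfolding center_regular_iff unfolding n .
    show "orders_pairwise_coprime n ?q"
      using b_skew order
    proof (rule orders_pairwise_coprimeI)
      \<comment> \<open>A divisor of \<rho> divides \<ell>, so minimality of \<ell> still rules out
        common divisors.\<close>
      show "d = 1" if "d dvd \<rho>" "\<forall>i\<in>{1..n}. \<forall>j\<in>{1..n}. int d dvd b i j" for d
      proof -
        have "int d dvd int \<rho>"
          using that(1) by simp
        then have "d dvd l"
          unfolding \<rho>_int by simp
        then show ?thesis
          using minimal that(2) by (intro minimal_exponent_data_common_divisor)
      qed
      show "int \<rho> dvd b i j * b i' j'"
        if "1 \<le> i" "i < j" "j \<le> n" "1 \<le> i'" "i' < j'" "j' \<le> n" "(i, j) \<noteq> (i', j')" for i j i' j'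
        using kernel_separated_4_dvd[OF b4 l sep] that unfolding n \<rho>_int by blast
    qed
  next
    \<comment> \<open>Coprimality yields separation modulo \<rho> only; the Pfaffian lift carries it
      to \<ell>.\<close>
    assume "orders_pairwise_coprime n ?q"
    with b_skew have "kernel_separated n (int \<rho>) b"
      by (rule coprime_orders_imp_kernel_separated) (simp only: dvd_refl flip: order)
    then show "center_regular n p"
      unfolding center_regular_iff unfolding n \<rho>_int by (rule kernel_separated_4_lift[OF b4 l])
  qed
qed

end

subsection \<open>Two variables\<close>

context skew
begin

lemma to_model_mult:
  "X \<in> carrier (skew_poly_ring n p) \<Longrightarrow> Y \<in> carrier (skew_poly_ring n p) \<Longrightarrow>
    to_model (X \<otimes>\<^bsub>skew_poly_ring n p\<^esub> Y) = tmult sig (to_model X) (to_model Y)"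
  using ring_iso_memE(2)[OF to_model_iso, of X Y] by (simp add: model_def)

lemma to_model_add:
  "X \<in> carrier (skew_poly_ring n p) \<Longrightarrow> Y \<in> carrier (skew_poly_ring n p) \<Longrightarrow>
    to_model (X \<oplus>\<^bsub>skew_poly_ring n p\<^esub> Y) = to_model X + to_model Y"
  using ring_iso_memE(3)[OF to_model_iso, of X Y] by (simp add: model_def)

lemma to_model_one: "to_model \<one>\<^bsub>skew_poly_ring n p\<^esub> = 1"
  using ring_iso_memE(4)[OF to_model_iso] by (simp add: model_def)

lemma to_model_a_inv:
  assumes "X \<in> carrier (skew_poly_ring n p)"
  shows "to_model (\<ominus>\<^bsub>skew_poly_ring n p\<^esub> X) = - to_model X"
proof -
  let ?S = "skew_poly_ring n p"
  note S = ring.ring_simprules[OF skew_poly_ring_ring[of n p]]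
  have "to_model \<zero>\<^bsub>?S\<^esub> + to_model \<zero>\<^bsub>?S\<^esub> = to_model (\<zero>\<^bsub>?S\<^esub> \<oplus>\<^bsub>?S\<^esub> \<zero>\<^bsub>?S\<^esub>)"
    using to_model_add[OF S(2) S(2)] by simp
  then have "to_model \<zero>\<^bsub>?S\<^esub> = 0"
    unfolding ring.ring_simprules(8)[OF skew_poly_ring_ring S(2)] add_cancel_left_right .
  moreover have "to_model (\<ominus>\<^bsub>?S\<^esub> X) + to_model X = to_model \<zero>\<^bsub>?S\<^esub>"
    unfolding to_model_add[OF ring.ring_simprules(3)[OF skew_poly_ring_ring assms] assms, symmetric]
    by (simp add: ring.ring_simprules(9)[OF skew_poly_ring_ring assms])
  ultimately show ?thesis
    by (simp add: eq_neg_iff_add_eq_0)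
qed

lemma to_model_var_power:
  assumes i: "i \<in> {1..n}"
  shows "skew_var n p i [^]\<^bsub>skew_poly_ring n p\<^esub> k \<in> carrier (skew_poly_ring n p) \<and>
    to_model (skew_var n p i [^]\<^bsub>skew_poly_ring n p\<^esub> (k :: nat)) = single (single i k) 1"
proof (induction k)
  case 0
  show ?case
    by (simp add: to_model_one monoid.one_closed ring.is_monoid skew_poly_ring_ring)
next
  case (Suc k)
  have sig: "sig (single i k) (single i 1) = 1"
    using i by (simp add: sig_single_single)
  show ?case
    using Suc skew_var_in_carrier[OF i] ring.ring_simprules(5)[OF skew_poly_ring_ring[of n p]]
    by (simp add: to_model_mult to_model_var[OF i] sig[simplified] flip: single_add)
qed

text \<open>Lets membership in Z be read off from the monomials occurring in the model.\<close>

lemma carrier_skew_center: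
  "carrier (skew_center n p) =
    {X \<in> carrier (skew_poly_ring n p). keys (to_model X) \<subseteq> central_exponents}"
proof -
  have sub: "carrier (skew_center n p) \<subseteq> carrier (skew_poly_ring n p)"
    unfolding skew_center_def by (simp add: ring_center_subset)
  have img: "to_model ` carrier (skew_center n p) = {f. keys f \<subseteq> central_exponents}"
    using ring_iso_memE(5)[OF to_model_center_iso]
    by (simp add: bij_betw_def model_center_def)
  have inj: "inj_on to_model (carrier (skew_poly_ring n p))"
    using ring_iso_memE(5)[OF to_model_iso] by (rule bij_betw_imp_inj_on)
  show ?thesis
  proof (intro equalityI subsetI)
    fix X assume "X \<in> carrier (skew_center n p)"
    then show "X \<in> {X \<in> carrier (skew_poly_ring n p). keys (to_model X) \<subseteq> central_exponents}"
      using sub img by blast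
  next
    fix X assume "X \<in> {X \<in> carrier (skew_poly_ring n p). keys (to_model X) \<subseteq> central_exponents}"
    then have X: "X \<in> carrier (skew_poly_ring n p)" and "to_model X \<in> to_model ` carrier (skew_center n p)"
      unfolding img by simp_all
    then obtain Y where Y: "Y \<in> carrier (skew_center n p)" "to_model X = to_model Y"
      by blast
    then have "X = Y"
      using inj_onD[OF inj] X sub by blast
    with Y show "X \<in> carrier (skew_center n p)"
      by simp
  qed
qed

lemma generated_in_center:
  assumes V: "\<And>X. X \<in> V \<Longrightarrow> X \<in> carrier (skew_center n p)"
  shows "generated_subalgebra (skew_poly_ring n p) (skew_const n p) V \<subseteq> carrier (skew_center n p)"
proof
  note S = ring.ring_simprules[OF skew_poly_ring_ring[of n p]]
  fix X assume "X \<in> generated_subalgebra (skew_poly_ring n p) (skew_const n p) V"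
  then have "X \<in> generate_ring (skew_poly_ring n p) (range (skew_const n p) \<union> V)"
    by (simp only: generated_subalgebra_def)
  then have "X \<in> carrier (skew_poly_ring n p) \<and> keys (to_model X) \<subseteq> central_exponents"
  proof (induction rule: generate_ring.induct)
    case one
    then show ?case
      by (simp add: to_model_one S(6))
  next
    case (incl X)
    then show ?case
      using V[of X] by (auto simp: skew_const_in_carrier to_model_const carrier_skew_center split: if_splits)
  next
    case (a_inv X)
    then show ?case
      by (simp add: to_model_a_inv S(3))
  next
    case (eng_add X Y)
    then show ?case
      using keys_add[of "to_model X" "to_model Y"] by (auto simp: to_model_add S(1))
  next
    case (eng_mult X Y)
    then show ?case
      using keys_tmult[of sig "to_model X" "to_model Y"] central_exponents_add
      by (simp add: to_model_mult S(5)) blast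
  qed
  then show "X \<in> carrier (skew_center n p)"
    by (simp add: carrier_skew_center)
qed

end

context skew_exponents
begin

text \<open>Minimality makes \<ell> coprime to b_12, the only entry up to sign, so it can be
  cancelled from both congruences.\<close>

lemma central_exponents_2:
  assumes n: "n = 2"
  shows "central_exponents = {a \<in> exponents n. l dvd lookup a 1 \<and> l dvd lookup a 2}"
proof -
  have two: "{1..2::nat} = {1, 2}"
    by auto
  have b: "b 1 1 = 0" "b 2 2 = 0" "b 2 1 = - b 1 2"
    by (rule skew_symmetric_diag[OF b_skew] skew_symmetric_swap[OF b_skew]; simp add: n)+
  let ?d = "gcd l (nat \<bar>b 1 2\<bar>)"
  have "\<forall>i\<in>{1..n}. \<forall>j\<in>{1..n}. int ?d dvd b i j"
    unfolding n two using b by simp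
  then have "?d = 1"
    by (rule minimal_exponent_data_common_divisor[OF minimal gcd_dvd1])
  then have coprime: "coprime (int l) (b 1 2)"
    by (metis coprime_iff_gcd_eq_1 coprime_int_iff coprime_abs_right_iff int_nat_eq abs_ge_zero)
  have dvd: "int l dvd b 1 2 * int k \<longleftrightarrow> l dvd k" for k
    using coprime by (simp add: coprime_dvd_mult_right_iff)
  have "(\<forall>i\<in>{1..n}. int l dvd (\<Sum>j\<in>{1..n}. b i j * int (lookup a j)))
      \<longleftrightarrow> int l dvd b 1 2 * int (lookup a 2) \<and> int l dvd b 1 2 * int (lookup a 1)" for a
    unfolding n two using b by simp
  then show ?thesis
    unfolding set_eq_iff central_exponents_iff dvd by blast
qed

text \<open>The generators are central because their exponents are. Conversely, in the model every
  central monomial is a product of powers of the two generators.\<close>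

lemma center_2:
  assumes n: "n = 2"
  shows "carrier (skew_center n p) =
    generated_subalgebra (skew_poly_ring n p) (skew_const n p)
      {skew_var n p 1 [^]\<^bsub>skew_poly_ring n p\<^esub> l, skew_var n p 2 [^]\<^bsub>skew_poly_ring n p\<^esub> l}"
    (is "_ = generated_subalgebra ?S _ ?V")
proof
  have ij: "1 \<in> {1..n}" "2 \<in> {1..n}"
    using n by simp_all
  have powers: "X \<in> carrier ?S" "to_model X \<in> {single (single 1 l) 1, single (single 2 l) 1}"
    if "X \<in> ?V" for X
    using that to_model_var_power[OF ij(1), of l] to_model_var_power[OF ij(2), of l] by auto
  let ?G = "generated_subalgebra ?S (skew_const n p) ?V"
  have "X \<in> carrier (skew_center n p)" if "X \<in> ?V" for X
    using powers[OF that] ij unfolding carrier_skew_center central_exponents_2[OF n]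
    by (auto simp: lookup_single when_def)
  then show G: "?G \<subseteq> carrier (skew_center n p)"
    by (rule generated_in_center)
  then have G_carrier: "X \<in> carrier ?S" if "X \<in> ?G" for X
    using that unfolding carrier_skew_center by blast
  let ?M = "to_model ` ?G"
  have M_const: "single 0 c \<in> ?M" for c
    by (intro image_eqI[of _ _ "skew_const n p c"])
      (simp_all add: to_model_const generated_subalgebra_def generate_ring.incl)
  have M_add: "f + g \<in> ?M" if "f \<in> ?M" "g \<in> ?M" for f g
  proof -
    from that obtain X Y where XY: "X \<in> ?G" "f = to_model X" "Y \<in> ?G" "g = to_model Y"
      by blast
    then have "X \<oplus>\<^bsub>?S\<^esub> Y \<in> ?G"
      unfolding generated_subalgebra_def by (blast intro: generate_ring.eng_add)
    with XY show ?thesis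
      by (intro image_eqI[of _ _ "X \<oplus>\<^bsub>?S\<^esub> Y"]) (simp_all add: to_model_add G_carrier)
  qed
  have M_mult: "tmult sig f g \<in> ?M" if "f \<in> ?M" "g \<in> ?M" for f g
  proof -
    from that obtain X Y where XY: "X \<in> ?G" "f = to_model X" "Y \<in> ?G" "g = to_model Y"
      by blast
    then have "X \<otimes>\<^bsub>?S\<^esub> Y \<in> ?G"
      unfolding generated_subalgebra_def by (blast intro: generate_ring.eng_mult)
    with XY show ?thesis
      by (intro image_eqI[of _ _ "X \<otimes>\<^bsub>?S\<^esub> Y"]) (simp_all add: to_model_mult G_carrier)
  qed
  have M_var: "single (single i (l * t)) 1 \<in> ?M" if i: "i = 1 \<or> i = 2" for i t
  proof (induction t)
    case 0
    show ?case
      using M_const[of 1] by simp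
  next
    case (Suc t)
    have i': "i \<in> {1..n}"
      using i ij by blast
    have "single (single i l) 1 \<in> ?M"
      using i to_model_var_power[OF i', of l] unfolding generated_subalgebra_def
      by (intro image_eqI[of _ _ "skew_var n p i [^]\<^bsub>?S\<^esub> l"] generate_ring.incl) auto
    from M_mult[OF this Suc] show ?case
      using i' by (simp add: sig_single_single flip: single_add)
  qed
  have M_all: "f \<in> ?M" if "keys f \<subseteq> central_exponents" for f
    using that
  proof (induction f rule: poly_mapping_supp_induct)
    case zero
    show ?case
      using M_const[of 0] by simp
  next
    case (single a c)
    then obtain s t where st: "lookup a 1 = l * s" "lookup a 2 = l * t" and a: "a \<in> exponents n"
      unfolding central_exponents_2[OF n] by (auto elim!: dvdE)
    have "a = single 1 (l * s) + single 2 (l * t)"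
    proof (rule poly_mapping_eqI)
      fix j
      consider "j = 1" | "j = 2" | "j \<notin> {1..n}"
        using n by fastforce
      then show "lookup a j = lookup (single 1 (l * s) + single 2 (l * t)) j"
        using st exponents_eq_zero[OF a, of j] ij
        by cases (auto simp: lookup_add lookup_single when_def)
    qed
    \<comment> \<open>The factor in x_1 stands first, so the product is already ordered and carries
      no scalar.\<close>
    moreover have "tmult sig (single (single 1 (l * s)) 1) (single (single 2 (l * t)) 1) \<in> ?M"
      by (intro M_mult M_var) simp_all
    ultimately have "single a 1 \<in> ?M"
      using ij by (simp add: sig_single_single)
    from M_mult[OF M_const[of c] this] show ?case
      by simp
  next
    case (add f g)
    then show ?case
      by (intro M_add)
  qed
  show "carrier (skew_center n p) \<subseteq> ?G"
  proof
    fix X assume "X \<in> carrier (skew_center n p)"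
    then have X: "X \<in> carrier ?S" and "keys (to_model X) \<subseteq> central_exponents"
      unfolding carrier_skew_center by blast+
    from M_all[OF this(2)] obtain Y where Y: "Y \<in> ?G" "to_model X = to_model Y"
      by blast
    have "X = Y"
      using inj_onD[OF bij_betw_imp_inj_on[OF ring_iso_memE(5)[OF to_model_iso]] Y(2) X G_carrier[OF Y(1)]] .
    with Y show "X \<in> ?G"
      by simp
  qed
qed

text \<open>There is only one pair i < j, so pairwise coprimality holds vacuously.\<close>

lemma center_regular_2:
  assumes n: "n = 2"
  shows "center_regular n p"
proof -
  have "{(i, j). 1 \<le> i \<and> i < j \<and> j \<le> n} \<subseteq> {(1, 2)}"
    using n by auto
  then have "orders_pairwise_coprime n p"
    unfolding orders_pairwise_coprime_def pairwise_def by blast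
  then show ?thesis
    by (rule coprime_orders_imp_center_regular)
qed

end

theorem theorem0p7:
  fixes n l :: nat
    and p :: "nat \<Rightarrow> nat \<Rightarrow> 'k::field_char_0"
    and \<xi> :: 'k
    and b :: "nat \<Rightarrow> nat \<Rightarrow> int"
  assumes "mult_antisymmetric n p"
    and "\<forall>i \<in> {1..n}. \<forall>j \<in> {1..n}. root_of_unity (p i j)"
    and "minimal_exponent_data n p l \<xi> b"
    and "l > 1"
  shows
    "(n = 2 \<longrightarrow>
        carrier (skew_center n p) =
          generated_subalgebra (skew_poly_ring n p) (skew_const n p)
            {skew_var n p 1 [^]\<^bsub>skew_poly_ring n p\<^esub> l, skew_var n p 2 [^]\<^bsub>skew_poly_ring n p\<^esub> l} \<and>
        center_regular n p) \<and>
     (n = 3 \<longrightarrow> (center_regular n p \<longleftrightarrow> orders_pairwise_coprime n p)) \<and>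
     (n = 4 \<longrightarrow>
        (\<forall>(\<rho> :: nat) (\<omega> :: 'k). \<rho> = nat (gcd (int l) (pfaffian4 b)) \<and> primitive_root_of_unity \<rho> \<omega> \<longrightarrow>
          (center_regular n p \<longleftrightarrow>
            orders_pairwise_coprime n (\<lambda>i j. \<omega> ^ nat (gcd (b i j) (int \<rho>))))))"
proof -
  have skew: "skew_exponents n p l \<xi> b"
    using assms by unfold_locales
  show ?thesis
    using skew_exponents.center_2[OF skew] skew_exponents.center_regular_2[OF skew]
      skew_exponents.center_regular_3_iff[OF skew] skew_exponents.center_regular_4_iff[OF skew]
    by blast
qed

end
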